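(* Suppose $\Lambda\le\Gamma$ are hyperbolic groups, $\Lambda$ is non-elementary, the Cannon--Thurston map $\partial\Lambda\to\partial\Gamma$ exists, and $r,s>1$ are any visual parameters for visual metrics on $\partial\Lambda$ and $\partial\Gamma$, respectively. Let $\varepsilon$ be the modulus of continuity of the Cannon--Thurston map with respect to these visual metrics. Then there exist $\alpha,\beta>0$ such that for all $n\ge 0$, $$\varepsilon\left(\frac{\beta}{r^{\mathrm{Dist}_\Lambda^\Gamma(n)}}\right)\ \ge\ \frac{\alpha}{s^n}.$$
   Context: Finite generating sets of $\Lambda$ and $\Gamma$ are fixed, with word metrics $d_\Lambda,d_\Gamma$; these are used for all the notions below. A hyperbolic group is non-elementary if it contains a free subgroup of rank $2$. Distortion: $\mathrm{Dist}^\Gamma_\Lambda(n)=\max\{d_\Lambda(e,h)\mid h\in\Lambda,\ d_\Gamma(e,h)\le n\}$. Boundary: for a hyperbolic group (or hyperbolic metric space) $X$ with basepoint $e$, $(a\cdot b)_e=\frac12(d(a,e)+d(b,e)-d(a,b))$ for $a,b\in X$; $\partial X$ is the set of equivalence classes of sequences $(a_n)$ in $X$ with $(a_m\cdot a_n)_e\to\infty$ as $m,n\to\infty$, where $(a_n)\sim(b_n)$ when $(a_m\cdot b_n)_e\to\infty$ as $m,n\to\infty$. For $a,b\in\partial X$, $(a\cdot b)_e=\sup\liminf_{m,n\to\infty}(a_m\cdot b_n)_e$, the supremum being over all sequences $(a_m),(b_n)$ representing $a,b$. A metric $d$ on $\partial X$ is a visual metric with visual parameter $r>1$ when there exist $k_1,k_2>0$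 with $k_1r^{-(a\cdot b)_e}\le d(a,b)\le k_2r^{-(a\cdot b)_e}$ for all $a,b\in\partial X$. Cannon--Thurston map: with $\overline G=G\cup\partial G$ the Gromov compactification (usual compact metrizable topology, in which a sequence in $G$ converges to a point of $\partial G$ iff it represents that point), the Cannon--Thurston map exists when the inclusion $\Lambda\hookrightarrow\Gamma$ extends to a continuous map $\overline\Lambda\to\overline\Gamma$; the Cannon--Thurston map is its restriction $\partial\Lambda\to\partial\Gamma$. Modulus of continuity of $f:U\to V$ between metric spaces: $\varepsilon(\delta)=\sup\{d_V(f(a),f(b))\mid a,b\in U,\ d_U(a,b)\le\delta\}\in[0,\infty]$. *)

theory Defs
  imports "HOL-Analysis.Analysis" "HOL-Algebra.Generated_Groups"
begin

section \<open>Free groups and non-elementary groups\<close>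

text \<open>
  HOL-Algebra has no non-abelian free groups. The letter \<open>(x, True)\<close> stands for the generator \<open>x\<close>,
  and \<open>(x, False)\<close> for its inverse.
\<close>

definition inv_letter :: "'x \<times> bool \<Rightarrow> 'x \<times> bool" where
  "inv_letter l = (fst l, \<not> snd l)"

definition reduced_word :: "('x \<times> bool) list \<Rightarrow> bool" where
  "reduced_word w \<longleftrightarrow> (\<forall>i. Suc i < length w \<longrightarrow> w ! Suc i \<noteq> inv_letter (w ! i))"

fun cons_cancel :: "'x \<times> bool \<Rightarrow> ('x \<times> bool) list \<Rightarrow> ('x \<times> bool) list" where
  "cons_cancel l [] = [l]"
| "cons_cancel l (m # w) = (if m = inv_letter l then w else l # m # w)"

definition free_group :: "'x set \<Rightarrow> ('x \<times> bool) list monoid" where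
  "free_group X =
     \<lparr>carrier = {w. reduced_word w \<and> fst ` set w \<subseteq> X}, mult = foldr cons_cancel, one = []\<rparr>"

lemma inv_letter_inv_letter [simp]: "inv_letter (inv_letter l) = l"
  by (simp add: inv_letter_def)

lemma fst_inv_letter [simp]: "fst (inv_letter l) = fst l"
  by (simp add: inv_letter_def)

lemma inv_letter_neq [simp]: "inv_letter l \<noteq> l" "l \<noteq> inv_letter l"
  by (auto simp: inv_letter_def prod_eq_iff)

lemma reduced_word_Nil [simp]: "reduced_word []"
  by (simp add: reduced_word_def)

lemma reduced_word_singleton [simp]: "reduced_word [l]"
  by (simp add: reduced_word_def)

lemma reduced_word_Cons_Cons [simp]:
  "reduced_word (l # m # w) \<longleftrightarrow> m \<noteq> inv_letter l \<and> reduced_word (m # w)"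
  by (auto simp: reduced_word_def nth_Cons split: nat.splits)

lemma reduced_word_ConsD: "reduced_word (l # w) \<Longrightarrow> reduced_word w"
  by (cases w) auto

lemma reduced_word_cons_cancel: "reduced_word w \<Longrightarrow> reduced_word (cons_cancel l w)"
  by (cases w) (auto dest: reduced_word_ConsD)

lemma reduced_word_foldr_cons_cancel:
  "reduced_word w \<Longrightarrow> reduced_word (foldr cons_cancel u w)"
  by (induction u) (auto intro: reduced_word_cons_cancel)

lemma set_cons_cancel: "set (cons_cancel l w) \<subseteq> insert l (set w)"
  by (cases w) auto

lemma set_foldr_cons_cancel: "set (foldr cons_cancel u w) \<subseteq> set u \<union> set w"
proof (induction u)
  case (Cons l u)
  then show ?case using set_cons_cancel[of l "foldr cons_cancel u w"] by auto
qed auto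

lemma cons_cancel_inv_letter:
  "reduced_word w \<Longrightarrow> cons_cancel l (cons_cancel (inv_letter l) w) = w"
  by (cases w rule: remdups_adj.cases) auto

lemma foldr_cons_cancel_assoc:
  assumes "reduced_word w"
  shows "foldr cons_cancel (foldr cons_cancel u v) w =
         foldr cons_cancel u (foldr cons_cancel v w)"
proof (induction u)
  case (Cons l u)
  have "foldr cons_cancel (cons_cancel l v') w = cons_cancel l (foldr cons_cancel v' w)" for v'
    using cons_cancel_inv_letter[OF reduced_word_foldr_cons_cancel[OF assms]]
    by (cases v') auto
  then show ?case using Cons by simp
qed simp

lemma foldr_cons_cancel_Nil: "reduced_word w \<Longrightarrow> foldr cons_cancel w [] = w"
proof (induction w)
  case (Cons l w)
  then show ?case by (cases w) (auto dest: reduced_word_ConsD)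
qed simp

lemma foldr_cons_cancel_inverse:
  "foldr cons_cancel (rev (map inv_letter w)) (foldr cons_cancel w v) = v" if "reduced_word v"
proof (induction w)
  case (Cons l w)
  have "cons_cancel (inv_letter l) (cons_cancel l (foldr cons_cancel w v)) = foldr cons_cancel w v"
    using cons_cancel_inv_letter[OF reduced_word_foldr_cons_cancel[OF that], of "inv_letter l" w]
    by simp
  then show ?case using Cons by simp
qed simp

lemma group_free_group: "group (free_group X)"
proof (rule groupI)
  fix u v assume u: "u \<in> carrier (free_group X)" and v: "v \<in> carrier (free_group X)"
  have "fst ` set (foldr cons_cancel u v) \<subseteq> fst ` (set u \<union> set v)"
    using set_foldr_cons_cancel by (rule image_mono)
  also have "\<dots> \<subseteq> X"
    using u v by (simp add: free_group_def image_Un)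
  finally show "u \<otimes>\<^bsub>free_group X\<^esub> v \<in> carrier (free_group X)"
    using v by (simp add: free_group_def reduced_word_foldr_cons_cancel)
next
  fix w assume w: "w \<in> carrier (free_group X)"
  let ?r = "foldr cons_cancel (rev (map inv_letter w)) []"
  have "set ?r \<subseteq> inv_letter ` set w"
    using set_foldr_cons_cancel[of "rev (map inv_letter w)" "[]"] by auto
  then have "fst ` set ?r \<subseteq> fst ` (inv_letter ` set w)" by (rule image_mono)
  then have "fst ` set ?r \<subseteq> fst ` set w" by (simp add: image_image)
  then have "?r \<in> carrier (free_group X)"
    using w by (simp add: free_group_def reduced_word_foldr_cons_cancel subset_trans)
  moreover have "foldr cons_cancel ?r w = []"
    using w foldr_cons_cancel_assoc[of w "rev (map inv_letter w)" "[]"]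
      foldr_cons_cancel_inverse[of "[]" w] by (simp add: free_group_def foldr_cons_cancel_Nil)
  ultimately show "\<exists>v\<in>carrier (free_group X). v \<otimes>\<^bsub>free_group X\<^esub> w = \<one>\<^bsub>free_group X\<^esub>"
    by (auto simp: free_group_def)
qed (auto simp: free_group_def foldr_cons_cancel_assoc)

definition non_elementary :: "('a, 'b) monoid_scheme \<Rightarrow> bool" where
  "non_elementary G \<longleftrightarrow>
     (\<exists>K. subgroup K G \<and> free_group (UNIV :: bool set) \<cong> G\<lparr>carrier := K\<rparr>)"


section \<open>Word metrics and distortion\<close>

definition finite_generating_set :: "('a, 'b) monoid_scheme \<Rightarrow> 'a set \<Rightarrow> bool" where
  "finite_generating_set G S \<longleftrightarrow> finite S \<and> S \<subseteq> carrier G \<and> generate G S = carrier G"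

definition word_length :: "('a, 'b) monoid_scheme \<Rightarrow> 'a set \<Rightarrow> 'a \<Rightarrow> nat" where
  "word_length G S g =
     (LEAST n. \<exists>ws. length ws = n \<and> set ws \<subseteq> S \<union> m_inv G ` S \<and> foldr (mult G) ws \<one>\<^bsub>G\<^esub> = g)"

definition word_dist :: "('a, 'b) monoid_scheme \<Rightarrow> 'a set \<Rightarrow> 'a \<Rightarrow> 'a \<Rightarrow> nat" where
  "word_dist G S g h = word_length G S (inv\<^bsub>G\<^esub> g \<otimes>\<^bsub>G\<^esub> h)"

text \<open>
  \<open>distortion L T G S n\<close> is $\mathrm{Dist}^G_L(n)$ for a subgroup \<open>L\<close> of \<open>G\<close>, with
  generating sets \<open>T\<close> of \<open>L\<close> and \<open>S\<close> of \<open>G\<close>.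
\<close>

definition distortion ::
  "('a, 'b) monoid_scheme \<Rightarrow> 'a set \<Rightarrow> ('a, 'c) monoid_scheme \<Rightarrow> 'a set \<Rightarrow> nat \<Rightarrow> nat" where
  "distortion L T G S n =
     Max {word_dist L T \<one>\<^bsub>L\<^esub> h |h. h \<in> carrier L \<and> word_dist G S \<one>\<^bsub>G\<^esub> h \<le> n}"


section \<open>Hyperbolicity and the Gromov boundary\<close>

definition gromov_product :: "('a \<Rightarrow> 'a \<Rightarrow> real) \<Rightarrow> 'a \<Rightarrow> 'a \<Rightarrow> 'a \<Rightarrow> real" where
  "gromov_product d e a b = (d a e + d b e - d a b) / 2"

definition gromov_hyperbolic :: "'a set \<Rightarrow> ('a \<Rightarrow> 'a \<Rightarrow> real) \<Rightarrow> bool" where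
  "gromov_hyperbolic X d \<longleftrightarrow>
     (\<exists>\<delta>. \<forall>x\<in>X. \<forall>y\<in>X. \<forall>z\<in>X. \<forall>w\<in>X.
        gromov_product d w x z \<ge> min (gromov_product d w x y) (gromov_product d w y z) - \<delta>)"

definition hyperbolic_group :: "('a, 'b) monoid_scheme \<Rightarrow> 'a set \<Rightarrow> bool" where
  "hyperbolic_group G S \<longleftrightarrow>
     group G \<and> finite_generating_set G S \<and> gromov_hyperbolic (carrier G) (word_dist G S)"

definition products_diverge ::
  "('a \<Rightarrow> 'a \<Rightarrow> real) \<Rightarrow> 'a \<Rightarrow> (nat \<Rightarrow> 'a) \<Rightarrow> (nat \<Rightarrow> 'a) \<Rightarrow> bool" where
  "products_diverge d e a b \<longleftrightarrow>
     filterlim (\<lambda>(m, n). gromov_product d e (a m) (b n)) at_top (sequentially \<times>\<^sub>F sequentially)"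

definition gromov_sequences ::
  "'a set \<Rightarrow> ('a \<Rightarrow> 'a \<Rightarrow> real) \<Rightarrow> 'a \<Rightarrow> (nat \<Rightarrow> 'a) set" where
  "gromov_sequences X d e = {a. range a \<subseteq> X \<and> products_diverge d e a a}"

definition gromov_boundary ::
  "'a set \<Rightarrow> ('a \<Rightarrow> 'a \<Rightarrow> real) \<Rightarrow> 'a \<Rightarrow> (nat \<Rightarrow> 'a) set set" where
  "gromov_boundary X d e =
     gromov_sequences X d e //
       {(a, b). a \<in> gromov_sequences X d e \<and> b \<in> gromov_sequences X d e \<and> products_diverge d e a b}"

definition boundary_product ::
  "('a \<Rightarrow> 'a \<Rightarrow> real) \<Rightarrow> 'a \<Rightarrow> (nat \<Rightarrow> 'a) set \<Rightarrow> (nat \<Rightarrow> 'a) set \<Rightarrow> ereal" where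
  "boundary_product d e A B =
     (SUP (a, b) \<in> A \<times> B.
        Liminf (sequentially \<times>\<^sub>F sequentially) (\<lambda>(m, n). ereal (gromov_product d e (a m) (b n))))"

definition visual_power :: "real \<Rightarrow> ereal \<Rightarrow> real" where
  "visual_power r t = (if t = \<infinity> then 0 else r powr (- real_of_ereal t))"

definition visual_metric ::
  "'a set \<Rightarrow> ('a \<Rightarrow> 'a \<Rightarrow> real) \<Rightarrow> 'a \<Rightarrow> ((nat \<Rightarrow> 'a) set \<Rightarrow> (nat \<Rightarrow> 'a) set \<Rightarrow> real) \<Rightarrow> real \<Rightarrow> bool" where
  "visual_metric X d e D r \<longleftrightarrow>
     Metric_space (gromov_boundary X d e) D \<and> r > 1 \<and>
     (\<exists>k1>0. \<exists>k2>0. \<forall>a\<in>gromov_boundary X d e. \<forall>b\<in>gromov_boundary X d e.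
        k1 * visual_power r (boundary_product d e a b) \<le> D a b \<and>
        D a b \<le> k2 * visual_power r (boundary_product d e a b))"


section \<open>The Gromov compactification and Cannon--Thurston maps\<close>

text \<open>
  In the compactification, \<open>Inl x\<close> is the point \<open>x\<close> of \<open>X\<close> and \<open>Inr \<xi>\<close> the boundary point \<open>\<xi>\<close>.
  To define $(p \cdot \xi)_e$ also for \<open>p\<close> in \<open>X\<close>, such a point is represented by its
  constant sequence.
\<close>

definition compactification ::
  "'a set \<Rightarrow> ('a \<Rightarrow> 'a \<Rightarrow> real) \<Rightarrow> 'a \<Rightarrow> ('a + (nat \<Rightarrow> 'a) set) set" where
  "compactification X d e = Inl ` X \<union> Inr ` gromov_boundary X d e"

primrec representatives :: "'a + (nat \<Rightarrow> 'a) set \<Rightarrow> (nat \<Rightarrow> 'a) set" where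
  "representatives (Inl x) = {\<lambda>_. x}"
| "representatives (Inr \<xi>) = \<xi>"

text \<open>
  The points of \<open>X\<close> are isolated (\<open>X\<close> will be a group with a word metric), and the sets
  $\{p \mid (p \cdot \xi)_e > R\}$ form, for hyperbolic \<open>X\<close>, a neighbourhood base at a boundary
  point \<open>\<xi>\<close>. A sequence in \<open>X\<close> then converges to \<open>\<xi>\<close> iff it represents \<open>\<xi>\<close>.
\<close>

definition compactification_open ::
  "'a set \<Rightarrow> ('a \<Rightarrow> 'a \<Rightarrow> real) \<Rightarrow> 'a \<Rightarrow> ('a + (nat \<Rightarrow> 'a) set) set \<Rightarrow> bool" where
  "compactification_open X d e U \<longleftrightarrow>
     U \<subseteq> compactification X d e \<and>
     (\<forall>\<xi>. Inr \<xi> \<in> U \<longrightarrow>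
        (\<exists>R::real. \<forall>p\<in>compactification X d e.
           boundary_product d e (representatives p) \<xi> > ereal R \<longrightarrow> p \<in> U))"

definition compactification_topology ::
  "'a set \<Rightarrow> ('a \<Rightarrow> 'a \<Rightarrow> real) \<Rightarrow> 'a \<Rightarrow> ('a + (nat \<Rightarrow> 'a) set) topology" where
  "compactification_topology X d e = topology (compactification_open X d e)"

lemma istopology_compactification_open: "istopology (compactification_open X d e)"
  unfolding istopology_def
proof (intro conjI allI impI)
  fix U V assume U: "compactification_open X d e U" and V: "compactification_open X d e V"
  show "compactification_open X d e (U \<inter> V)"
    unfolding compactification_open_def
  proof (intro conjI allI impI)
    show "U \<inter> V \<subseteq> compactification X d e"
      using U by (auto simp: compactification_open_def)
    fix \<xi> assume "Inr \<xi> \<in> U \<inter> V"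
    then obtain R1 R2 :: real where
      "\<And>p. \<lbrakk>p \<in> compactification X d e; boundary_product d e (representatives p) \<xi> > ereal R1\<rbrakk> \<Longrightarrow> p \<in> U"
      "\<And>p. \<lbrakk>p \<in> compactification X d e; boundary_product d e (representatives p) \<xi> > ereal R2\<rbrakk> \<Longrightarrow> p \<in> V"
      using U V unfolding compactification_open_def by (metis Int_iff)
    moreover have "t > ereal R1 \<and> t > ereal R2" if "t > ereal (max R1 R2)" for t
      using that by (metis ereal_less_eq(3) max.cobounded1 max.cobounded2 order_le_less_trans)
    ultimately show "\<exists>R::real. \<forall>p\<in>compactification X d e.
        boundary_product d e (representatives p) \<xi> > ereal R \<longrightarrow> p \<in> U \<inter> V"
      by (intro exI[of _ "max R1 R2"]) blast
  qed
next
  fix K assume K: "\<forall>U\<in>K. compactification_open X d e U"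
  show "compactification_open X d e (\<Union>K)"
    unfolding compactification_open_def
  proof (intro conjI allI impI)
    show "\<Union>K \<subseteq> compactification X d e"
      using K by (auto simp: compactification_open_def)
    fix \<xi> assume "Inr \<xi> \<in> \<Union>K"
    then obtain U where "U \<in> K" "Inr \<xi> \<in> U" by blast
    with K show "\<exists>R::real. \<forall>p\<in>compactification X d e.
        boundary_product d e (representatives p) \<xi> > ereal R \<longrightarrow> p \<in> \<Union>K"
      unfolding compactification_open_def by (meson UnionI)
  qed
qed

lemma openin_compactification_topology:
  "openin (compactification_topology X d e) = compactification_open X d e"
  by (simp add: compactification_topology_def topology_inverse' istopology_compactification_open)

lemma topspace_compactification_topology [simp]:
  "topspace (compactification_topology X d e) = compactification X d e"
proof (rule antisym)
  show "topspace (compactification_topology X d e) \<subseteq> compactification X d e"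
    using openin_topspace[of "compactification_topology X d e"]
    unfolding openin_compactification_topology compactification_open_def by blast
  have "openin (compactification_topology X d e) (compactification X d e)"
    unfolding openin_compactification_topology compactification_open_def by blast
  then show "compactification X d e \<subseteq> topspace (compactification_topology X d e)"
    by (rule openin_subset)
qed

abbreviation group_boundary :: "('a, 'b) monoid_scheme \<Rightarrow> 'a set \<Rightarrow> (nat \<Rightarrow> 'a) set set" where
  "group_boundary G S \<equiv> gromov_boundary (carrier G) (word_dist G S) \<one>\<^bsub>G\<^esub>"

abbreviation group_compactification ::
  "('a, 'b) monoid_scheme \<Rightarrow> 'a set \<Rightarrow> ('a + (nat \<Rightarrow> 'a) set) topology" where
  "group_compactification G S \<equiv> compactification_topology (carrier G) (word_dist G S) \<one>\<^bsub>G\<^esub>"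

abbreviation group_visual_metric ::
  "('a, 'b) monoid_scheme \<Rightarrow> 'a set \<Rightarrow>
     ((nat \<Rightarrow> 'a) set \<Rightarrow> (nat \<Rightarrow> 'a) set \<Rightarrow> real) \<Rightarrow> real \<Rightarrow> bool" where
  "group_visual_metric G S \<equiv> visual_metric (carrier G) (word_dist G S) \<one>\<^bsub>G\<^esub>"

definition cannon_thurston_extension ::
  "('a, 'b) monoid_scheme \<Rightarrow> 'a set \<Rightarrow> ('a, 'c) monoid_scheme \<Rightarrow> 'a set \<Rightarrow>
     ('a + (nat \<Rightarrow> 'a) set \<Rightarrow> 'a + (nat \<Rightarrow> 'a) set) \<Rightarrow> bool" where
  "cannon_thurston_extension L T G S F \<longleftrightarrow>
     continuous_map (group_compactification L T) (group_compactification G S) F \<and>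
     (\<forall>h\<in>carrier L. F (Inl h) = Inl h)"

definition cannon_thurston_exists ::
  "('a, 'b) monoid_scheme \<Rightarrow> 'a set \<Rightarrow> ('a, 'c) monoid_scheme \<Rightarrow> 'a set \<Rightarrow> bool" where
  "cannon_thurston_exists L T G S \<longleftrightarrow> (\<exists>F. cannon_thurston_extension L T G S F)"

text \<open>
  For hyperbolic groups \<open>L\<close> is dense in its compactification, that of \<open>G\<close> is Hausdorff, and the
  inclusion is proper. So all extensions agree on the compactification of \<open>L\<close>, which makes the
  choice below immaterial, and they map boundary points to boundary points.
\<close>

definition cannon_thurston_map ::
  "('a, 'b) monoid_scheme \<Rightarrow> 'a set \<Rightarrow> ('a, 'c) monoid_scheme \<Rightarrow> 'a set \<Rightarrow>
     (nat \<Rightarrow> 'a) set \<Rightarrow> (nat \<Rightarrow> 'a) set" where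
  "cannon_thurston_map L T G S \<xi> = projr ((SOME F. cannon_thurston_extension L T G S F) (Inr \<xi>))"

definition modulus_of_continuity ::
  "'u set \<Rightarrow> ('u \<Rightarrow> 'u \<Rightarrow> real) \<Rightarrow> ('v \<Rightarrow> 'v \<Rightarrow> real) \<Rightarrow> ('u \<Rightarrow> 'v) \<Rightarrow> real \<Rightarrow> ennreal" where
  "modulus_of_continuity U dU dV f \<delta> =
     Sup {ennreal (dV (f a) (f b)) |a b. a \<in> U \<and> b \<in> U \<and> dU a b \<le> \<delta>}"

end

theory Submission
  imports Defs
begin

text \<open>
  Choose \<open>h \<in> \<Lambda>\<close> realising the distortion at \<open>n\<close>. Given three boundary points of \<open>\<Lambda>\<close> with distinct images
  in the boundary of \<open>\<Gamma>\<close>, at most one of them is close to \<open>h\<^sup>-\<^sup>1\<close>, so that \<open>h\<close> moves the other two, \<open>\<xi>\<close> and \<open>\<eta>\<close>, into the shadow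
  of \<open>h\<close>, where \<open>(h\<xi> \<cdot> h\<eta>)\<close> is at least the \<open>\<Lambda>\<close>-length of \<open>h\<close> up to a constant. In \<open>\<Gamma>\<close>,
  translation by \<open>h\<close> changes the boundary product by at most the \<open>\<Gamma>\<close>-length of \<open>h\<close>, hence by at most \<open>n\<close>.

  The three points are translates of one boundary point of \<open>\<Lambda>\<close>: if there were at most two images, \<open>\<Lambda>\<close> would be
  covered by two cosets of the stabiliser of a boundary point of \<open>\<Gamma>\<close>, which grows linearly, whereas
  a free subgroup of rank two grows exponentially.
\<close>

section \<open>Word metrics\<close>

locale fg_group = group G for G (structure) +
  fixes S
  assumes fgs: "finite_generating_set G S"
begin

abbreviation "letters \<equiv> S \<union> m_inv G ` S"
abbreviation "eval_word ws \<equiv> foldr (mult G) ws \<one>"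
abbreviation "wlen \<equiv> word_length G S"
abbreviation "wdist \<equiv> word_dist G S"

lemma letters_closed: "letters \<subseteq> carrier G"
  using fgs by (auto simp: finite_generating_set_def)

lemma finite_letters: "finite letters"
  using fgs by (auto simp: finite_generating_set_def)

lemma eval_word_closed: "set ws \<subseteq> carrier G \<Longrightarrow> eval_word ws \<in> carrier G"
  by (induction ws) auto

lemma eval_word_append:
  "set us \<subseteq> carrier G \<Longrightarrow> set ws \<subseteq> carrier G \<Longrightarrow> eval_word (us @ ws) = eval_word us \<otimes> eval_word ws"
proof (induction us)
  case (Cons u us)
  have "foldr (\<otimes>) ws \<one> \<in> carrier G" "foldr (\<otimes>) us \<one> \<in> carrier G"
    using Cons.prems by (auto intro!: eval_word_closed)
  then show ?case using Cons by (simp add: m_assoc)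
qed (simp add: eval_word_closed)

lemma eval_word_inverse:
  "set us \<subseteq> carrier G \<Longrightarrow> eval_word (rev (map (m_inv G) us)) = inv (eval_word us)"
proof (induction us)
  case (Cons u us)
  have "set (rev (map (m_inv G) us)) \<subseteq> carrier G" using Cons.prems by auto
  then have "eval_word (rev (map (m_inv G) us) @ [inv u]) = inv (eval_word us) \<otimes> inv u"
    using Cons by (subst eval_word_append) auto
  then show ?case using Cons.prems by (simp add: inv_mult_group eval_word_closed)
qed simp

lemma ex_word:
  assumes "x \<in> carrier G"
  shows "\<exists>ws. set ws \<subseteq> letters \<and> eval_word ws = x"
proof -
  have "x \<in> generate G S" using assms fgs by (simp add: finite_generating_set_def)
  then show ?thesis
  proof induction
    case one
    show ?case by (rule exI[of _ "[]"]) simp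
  next
    case (incl h)
    then show ?case using letters_closed by (intro exI[of _ "[h]"]) auto
  next
    case (inv h)
    then show ?case using letters_closed by (intro exI[of _ "[inv h]"]) auto
  next
    case (eng h1 h2)
    then obtain us ws where "set us \<subseteq> letters" "eval_word us = h1" "set ws \<subseteq> letters" "eval_word ws = h2"
      by blast
    then show ?case using letters_closed
      by (intro exI[of _ "us @ ws"]) (simp add: eval_word_append[OF subset_trans subset_trans] del: foldr_append)
  qed
qed

lemma wlen_word:
  assumes "x \<in> carrier G"
  obtains ws where "length ws = wlen x" "set ws \<subseteq> letters" "eval_word ws = x"
proof -
  obtain ws where "set ws \<subseteq> letters" "eval_word ws = x"
    using ex_word[OF assms] by blast
  then have "\<exists>n. \<exists>ws. length ws = n \<and> set ws \<subseteq> letters \<and> eval_word ws = x" by blast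
  from LeastI_ex[OF this] show ?thesis using that unfolding word_length_def by blast
qed

lemma wlen_eval_le: "set ws \<subseteq> letters \<Longrightarrow> wlen (eval_word ws) \<le> length ws"
  unfolding word_length_def by (rule Least_le) blast

lemma wlen_one [simp]: "wlen \<one> = 0"
  using wlen_eval_le[of "[]"] by simp

lemma wlen_letter: "x \<in> letters \<Longrightarrow> wlen x \<le> 1"
  using wlen_eval_le[of "[x]"] letters_closed by auto

lemma wlen_mult:
  assumes "x \<in> carrier G" "y \<in> carrier G"
  shows "wlen (x \<otimes> y) \<le> wlen x + wlen y"
proof -
  obtain us where us: "length us = wlen x" "set us \<subseteq> letters" "eval_word us = x"
    using wlen_word assms(1) by blast
  obtain ws where ws: "length ws = wlen y" "set ws \<subseteq> letters" "eval_word ws = y"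
    using wlen_word assms(2) by blast
  have "eval_word (us @ ws) = x \<otimes> y"
    using us ws letters_closed by (subst eval_word_append) auto
  then show ?thesis using wlen_eval_le[of "us @ ws"] us ws by simp
qed

lemma wlen_inv_le:
  assumes "x \<in> carrier G"
  shows "wlen (inv x) \<le> wlen x"
proof -
  obtain us where us: "length us = wlen x" "set us \<subseteq> letters" "eval_word us = x"
    using wlen_word assms(1) by blast
  have "set us \<subseteq> carrier G" using us letters_closed by blast
  then have "eval_word (rev (map (m_inv G) us)) = inv x"
    using eval_word_inverse us by blast
  moreover have "set (rev (map (m_inv G) us)) \<subseteq> letters"
  proof -
    have "inv u \<in> letters" if "u \<in> letters" for u
    proof (cases "u \<in> S")
      case False
      then obtain v where "v \<in> S" "u = inv v" using \<open>u \<in> letters\<close> by blast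
      moreover have "v \<in> carrier G" using letters_closed \<open>v \<in> S\<close> by blast
      ultimately show ?thesis by simp
    qed blast
    then have "m_inv G ` set us \<subseteq> letters" using us(2) by blast
    then show ?thesis by simp
  qed
  ultimately show ?thesis using wlen_eval_le[of "rev (map (m_inv G) us)"] us by simp
qed

lemma wlen_inv [simp]: "x \<in> carrier G \<Longrightarrow> wlen (inv x) = wlen x"
  using wlen_inv_le[of x] wlen_inv_le[of "inv x"] by simp

lemma finite_wlen_ball: "finite {x \<in> carrier G. wlen x \<le> n}"
proof (rule finite_subset)
  show "{x \<in> carrier G. wlen x \<le> n} \<subseteq> eval_word ` {ws. set ws \<subseteq> letters \<and> length ws \<le> n}"
  proof
    fix x assume "x \<in> {x \<in> carrier G. wlen x \<le> n}"
    then show "x \<in> eval_word ` {ws. set ws \<subseteq> letters \<and> length ws \<le> n}"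
      using wlen_word[of x] by (metis (mono_tags, lifting) imageI mem_Collect_eq)
  qed
  show "finite (eval_word ` {ws. set ws \<subseteq> letters \<and> length ws \<le> n})"
    using finite_lists_length_le[OF finite_letters] by blast
qed

lemma wdist_translate:
  assumes "g \<in> carrier G" "x \<in> carrier G" "y \<in> carrier G"
  shows "wdist (g \<otimes> x) (g \<otimes> y) = wdist x y"
  using assms by (simp add: word_dist_def inv_mult_group m_assoc)
    (metis inv_closed l_inv l_one m_assoc m_closed)

lemma wdist_self: "x \<in> carrier G \<Longrightarrow> wdist x x = 0"
  by (simp add: word_dist_def)

lemma wdist_commute: "x \<in> carrier G \<Longrightarrow> y \<in> carrier G \<Longrightarrow> wdist x y = wdist y x"
  using wlen_inv[of "inv x \<otimes> y"] by (simp add: word_dist_def inv_mult_group)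

lemma wdist_triangle:
  assumes "x \<in> carrier G" "y \<in> carrier G" "z \<in> carrier G"
  shows "wdist x z \<le> wdist x y + wdist y z"
proof -
  have "(inv x \<otimes> y) \<otimes> (inv y \<otimes> z) = inv x \<otimes> z"
    using assms by (metis inv_closed inv_solve_left m_assoc m_closed)
  then show ?thesis
    unfolding word_dist_def using wlen_mult[of "inv x \<otimes> y" "inv y \<otimes> z"] assms by simp
qed

lemma wdist_one [simp]: "x \<in> carrier G \<Longrightarrow> wdist \<one> x = wlen x"
  by (simp add: word_dist_def)

lemma wdist_one' [simp]: "x \<in> carrier G \<Longrightarrow> wdist x \<one> = wlen x"
  by (simp add: word_dist_def)

section \<open>Geodesics in the word metric\<close>

text \<open>A shortest word for \<open>x\<close> is cut after \<open>N\<close> letters. The lengths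
  of the two pieces are at most \<open>N\<close> and \<open>wlen x - N\<close> and add up to at
  least \<open>wlen x\<close>, so both bounds are equalities.\<close>

lemma geodesic_point:
  assumes x: "x \<in> carrier G" and N: "N \<le> wlen x"
  obtains g where "g \<in> carrier G" "wlen g = N" "wdist g x + N = wlen x"
proof -
  obtain ws where ws: "length ws = wlen x" "set ws \<subseteq> letters" "eval_word ws = x"
    using wlen_word x by blast
  define g where "g = eval_word (take N ws)"
  define y where "y = eval_word (drop N ws)"
  have t: "set (take N ws) \<subseteq> letters" "set (drop N ws) \<subseteq> letters"
    using ws(2) set_take_subset[of N ws] set_drop_subset[of N ws] by blast+
  have g: "g \<in> carrier G" "y \<in> carrier G"
    unfolding g_def y_def using t letters_closed by (auto intro!: eval_word_closed)
  have "eval_word (take N ws @ drop N ws) = g \<otimes> y"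
    unfolding g_def y_def using t letters_closed by (intro eval_word_append) auto
  then have xgy: "x = g \<otimes> y" using ws by simp
  then have "wdist g x = wlen y" using g by (simp add: word_dist_def m_assoc[symmetric])
  moreover have "wlen g \<le> N" using wlen_eval_le[OF t(1)] N ws(1) unfolding g_def by simp
  moreover have "wlen y \<le> wlen x - N" using wlen_eval_le[OF t(2)] N ws(1) unfolding y_def by simp
  moreover have "wlen x \<le> wlen g + wlen y" using wlen_mult g xgy by simp
  ultimately show ?thesis using that g N by simp
qed

text \<open>Koenig's lemma, applied to the prefixes of geodesics that extend to infinitely many group elements.\<close>

lemma ex_geodesic_ray:
  assumes inf: "infinite (carrier G)"
  obtains \<gamma> where "range \<gamma> \<subseteq> carrier G" "\<And>m n. m \<le> n \<Longrightarrow> wdist (\<gamma> m) (\<gamma> n) = n - m" "\<gamma> 0 = \<one>"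
proof -
  \<comment> \<open>The equation \<open>wdist g x + n = wlen x\<close> says that some geodesic from
    \<open>\<one>\<close> to \<open>x\<close> passes through \<open>g\<close>. So
    \<open>Q n g\<close> is the invariant of the construction: \<open>g\<close> lies on the sphere
    of radius \<open>n\<close> and has infinitely many elements behind it.\<close>
  define Q where "Q n g \<longleftrightarrow> g \<in> carrier G \<and> wlen g = n \<and>
    infinite {x \<in> carrier G. wdist g x + n = wlen x}" for n g
  have "{x \<in> carrier G. wdist \<one> x + 0 = wlen x} = carrier G" by auto
  then have Q0: "Q 0 \<one>" using inf by (simp only: Q_def) simp
  have step: "\<exists>g'. Q (Suc n) g' \<and> wdist g g' \<le> 1" if Q: "Q n g" for n g
  proof -
    have g: "g \<in> carrier G" "wlen g = n" and inf: "infinite {x \<in> carrier G. wdist g x + n = wlen x}"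
      using Q by (auto simp: Q_def)
    \<comment> \<open>If \<open>l\<close> is the first letter of a shortest word for
      \<open>inv g \<otimes> x\<close>, then \<open>g \<otimes> l\<close> lies on a geodesic to
      \<open>x\<close> as well. There are finitely many letters, so one of them inherits infinitely
      many \<open>x\<close>.\<close>
    have "{x \<in> carrier G. wdist g x + n = wlen x} \<subseteq>
      insert g (\<Union>l\<in>letters. {x \<in> carrier G. wdist (g \<otimes> l) x + Suc n = wlen x})"
    proof
      fix x assume "x \<in> {x \<in> carrier G. wdist g x + n = wlen x}"
      then have x: "x \<in> carrier G" "wdist g x + n = wlen x" by auto
      show "x \<in> insert g (\<Union>l\<in>letters. {x \<in> carrier G. wdist (g \<otimes> l) x + Suc n = wlen x})"
      proof (cases "x = g")
        case False
        define y where "y = inv g \<otimes> x"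
        have y: "y \<in> carrier G" "x = g \<otimes> y"
          using g x by (auto simp: y_def m_assoc[symmetric])
        obtain ws where ws: "length ws = wlen y" "set ws \<subseteq> letters" "eval_word ws = y"
          using wlen_word y by blast
        have "ws \<noteq> []" using ws y False g by auto
        then obtain l vs where lvs: "ws = l # vs" by (cases ws) auto
        define v where "v = eval_word vs"
        have l: "l \<in> letters" "l \<in> carrier G" using ws(2) lvs letters_closed by auto
        have v: "v \<in> carrier G" "wlen v < wlen y" "y = l \<otimes> v"
          using ws lvs letters_closed wlen_eval_le[of vs] unfolding v_def
          by (auto intro!: eval_word_closed)
        have "x = (g \<otimes> l) \<otimes> v" using y v g l by (simp add: m_assoc)
        then have d: "wdist (g \<otimes> l) x = wlen v"
          using g l v by (metis inv_solve_left' m_closed word_dist_def)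
        have "wlen x \<le> wlen (g \<otimes> l) + wlen v"
          using wlen_mult[of "g \<otimes> l" v] \<open>x = (g \<otimes> l) \<otimes> v\<close> g l v by simp
        moreover have "wlen (g \<otimes> l) \<le> Suc n"
          using wlen_mult[of g l] wlen_letter[OF l(1)] g l by simp
        moreover have "wdist g x = wlen y" by (simp add: y_def word_dist_def)
        ultimately have "wdist (g \<otimes> l) x + Suc n = wlen x" using x v d by linarith
        then show ?thesis using l x by blast
      qed simp
    qed
    then have "infinite (\<Union>l\<in>letters. {x \<in> carrier G. wdist (g \<otimes> l) x + Suc n = wlen x})"
      using inf by (meson finite_insert finite_subset)
    then obtain l where l: "l \<in> letters" and linf: "infinite {x \<in> carrier G. wdist (g \<otimes> l) x + Suc n = wlen x}"
      using finite_letters by blast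
    have lc: "l \<in> carrier G" using l letters_closed by blast
    obtain x where x: "x \<in> carrier G" "wdist (g \<otimes> l) x + Suc n = wlen x"
      using linf not_finite_existsD by auto
    have "wlen (g \<otimes> l) \<le> Suc n"
      using wlen_mult[of g l] wlen_letter[OF l(1)] g lc by simp
    moreover have "wlen x \<le> wlen (g \<otimes> l) + wdist (g \<otimes> l) x"
      using wdist_triangle[of \<one> "g \<otimes> l" x] g lc x by simp
    ultimately have "wlen (g \<otimes> l) = Suc n" using x by linarith
    moreover have "wdist g (g \<otimes> l) \<le> 1"
      using wlen_letter[OF l(1)] g lc by (simp add: word_dist_def m_assoc[symmetric])
    ultimately show ?thesis using linf g lc by (intro exI[of _ "g \<otimes> l"]) (auto simp: Q_def)
  qed
  define next_pt where "next_pt n g = (SOME g'. Q (Suc n) g' \<and> wdist g g' \<le> 1)" for n g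
  define \<gamma> where "\<gamma> = rec_nat \<one> next_pt"
  have \<gamma>0: "\<gamma> 0 = \<one>" and \<gamma>S: "\<gamma> (Suc n) = next_pt n (\<gamma> n)" for n by (auto simp: \<gamma>_def)
  have nx: "Q (Suc n) (next_pt n g) \<and> wdist g (next_pt n g) \<le> 1" if "Q n g" for n g
    unfolding next_pt_def by (rule someI_ex) (rule step[OF that])
  have Q\<gamma>: "Q n (\<gamma> n)" for n
    by (induction n) (use Q0 nx in \<open>auto simp: \<gamma>0 \<gamma>S\<close>)
  have c: "\<gamma> n \<in> carrier G" and len: "wlen (\<gamma> n) = n" for n using Q\<gamma>[of n] by (auto simp: Q_def)
  have up: "wdist (\<gamma> m) (\<gamma> (m + k)) \<le> k" for m k
  proof (induction k)
    case (Suc k)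
    have "wdist (\<gamma> (m + k)) (\<gamma> (Suc (m + k))) \<le> 1" using nx[OF Q\<gamma>] by (simp add: \<gamma>S)
    then show ?case using wdist_triangle[OF c c c, of m "m + Suc k" "m + k"] Suc by simp
  qed (simp add: wdist_self c)
  \<comment> \<open>Unit steps bound the distance from above; \<open>wlen (\<gamma> n) = n\<close>
    and the triangle inequality from \<open>\<one>\<close> bound it from below.\<close>
  have "wdist (\<gamma> m) (\<gamma> n) = n - m" if "m \<le> n" for m n
  proof -
    have "n \<le> m + wdist (\<gamma> m) (\<gamma> n)"
      using wdist_triangle[of \<one> "\<gamma> m" "\<gamma> n"] c len by simp
    then show ?thesis using up[of m "n - m"] that by simp
  qed
  then show ?thesis using that c \<gamma>0 by blast
qed

end


section \<open>Sequences and boundary points in hyperbolic spaces\<close>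

lemma products_diverge_iff:
  "products_diverge d e a b \<longleftrightarrow>
    (\<forall>R. \<exists>N. \<forall>m\<ge>N. \<forall>n\<ge>N. R \<le> gromov_product d e (a m) (b n))"
  unfolding products_diverge_def filterlim_at_top eventually_prod_sequentially prod.case by meson

text \<open>The constant \<open>\<delta>\<close> is a parameter, not existentially bound as in
  \<open>gromov_hyperbolic\<close>, so that the later estimates can name it.\<close>

locale hyperbolic_space =
  fixes X :: "'x set" and d :: "'x \<Rightarrow> 'x \<Rightarrow> real" and e :: 'x and \<delta> :: real
  assumes base: "e \<in> X"
    and dist_commute: "\<And>x y. x \<in> X \<Longrightarrow> y \<in> X \<Longrightarrow> d x y = d y x"
    and dist_self: "\<And>x. x \<in> X \<Longrightarrow> d x x = 0"
    and four_point: "\<And>w x y z. w \<in> X \<Longrightarrow> x \<in> X \<Longrightarrow> y \<in> X \<Longrightarrow> z \<in> X \<Longrightarrow>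
      min (gromov_product d w x y) (gromov_product d w y z) - \<delta> \<le> gromov_product d w x z"
begin

abbreviation "gp \<equiv> gromov_product d"
abbreviation "gseqs \<equiv> gromov_sequences X d e"
abbreviation "bdry \<equiv> gromov_boundary X d e"
abbreviation "bprod \<equiv> boundary_product d e"

definition seq_class :: "(nat \<Rightarrow> 'x) \<Rightarrow> (nat \<Rightarrow> 'x) set" where
  "seq_class a = {b \<in> gseqs. products_diverge d e a b}"

lemma gp_commute: "x \<in> X \<Longrightarrow> y \<in> X \<Longrightarrow> gp w x y = gp w y x"
  by (simp add: gromov_product_def dist_commute)

text \<open>In this form each intermediate point of a chain costs one \<open>\<delta>\<close>; the
  multiples of \<open>\<delta>\<close> below count such points.\<close>

lemma gp_ge:
  assumes "w \<in> X" "x \<in> X" "y \<in> X" "z \<in> X" "R \<le> gp w x y" "R \<le> gp w y z"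
  shows "R - \<delta> \<le> gp w x z"
  using four_point[OF assms(1-4)] assms(5,6) by linarith

lemma delta_nonneg: "0 \<le> \<delta>"
  using four_point[OF base base base base] by simp

lemma gseqs_in: "a \<in> gseqs \<Longrightarrow> a n \<in> X"
  by (auto simp: gromov_sequences_def)

lemma gseqs_diverge: "a \<in> gseqs \<Longrightarrow> products_diverge d e a a"
  by (simp add: gromov_sequences_def)

lemma products_diverge_sym:
  assumes "range a \<subseteq> X" "range b \<subseteq> X" "products_diverge d e a b"
  shows "products_diverge d e b a"
proof -
  have "gp e (a m) (b n) = gp e (b n) (a m)" for m n using assms gp_commute by blast
  then show ?thesis using assms(3) unfolding products_diverge_iff by metis
qed

lemma products_diverge_trans:
  assumes "range a \<subseteq> X" "range b \<subseteq> X" "range c \<subseteq> X"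
    "products_diverge d e a b" "products_diverge d e b c"
  shows "products_diverge d e a c"
  unfolding products_diverge_iff
proof
  fix R
  obtain N1 where N1: "\<And>m n. m \<ge> N1 \<Longrightarrow> n \<ge> N1 \<Longrightarrow> R + \<delta> \<le> gp e (a m) (b n)"
    using assms(4) unfolding products_diverge_iff by meson
  obtain N2 where N2: "\<And>m n. m \<ge> N2 \<Longrightarrow> n \<ge> N2 \<Longrightarrow> R + \<delta> \<le> gp e (b m) (c n)"
    using assms(5) unfolding products_diverge_iff by meson
  have "R \<le> gp e (a m) (c n)" if "m \<ge> max N1 N2" "n \<ge> max N1 N2" for m n
    using gp_ge[OF base, of "a m" "b (max N1 N2)" "c n" "R + \<delta>"] N1 N2 that assms(1-3)
    by (simp add: image_subset_iff)
  then show "\<exists>N. \<forall>m\<ge>N. \<forall>n\<ge>N. R \<le> gp e (a m) (c n)" by blast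
qed

text \<open>Failure of divergence only yields small products \<open>gp e (a k) (b l)\<close>
  arbitrarily far out. A large product of \<open>a m\<close> and \<open>b n\<close> far out would
  make these large too, through the chain \<open>a k\<close>, \<open>a m\<close>,
  \<open>b n\<close>, \<open>b l\<close>.\<close>

lemma not_products_diverge:
  assumes "a \<in> gseqs" "b \<in> gseqs" "\<not> products_diverge d e a b"
  shows "\<exists>C. \<exists>N. \<forall>m\<ge>N. \<forall>n\<ge>N. gp e (a m) (b n) \<le> C"
proof -
  obtain R where R: "\<And>N. \<exists>m\<ge>N. \<exists>n\<ge>N. gp e (a m) (b n) < R"
    using assms(3) unfolding products_diverge_iff by (meson not_le)
  obtain N1 where N1: "\<And>m n. m \<ge> N1 \<Longrightarrow> n \<ge> N1 \<Longrightarrow> R + 2 * \<delta> \<le> gp e (a m) (a n)"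
    using gseqs_diverge[OF assms(1)] unfolding products_diverge_iff by meson
  obtain N2 where N2: "\<And>m n. m \<ge> N2 \<Longrightarrow> n \<ge> N2 \<Longrightarrow> R + 2 * \<delta> \<le> gp e (b m) (b n)"
    using gseqs_diverge[OF assms(2)] unfolding products_diverge_iff by meson
  obtain k l where kl: "k \<ge> max N1 N2" "l \<ge> max N1 N2" "gp e (a k) (b l) < R" using R by blast
  have "gp e (a m) (b n) \<le> R + 2 * \<delta>" if "m \<ge> max N1 N2" "n \<ge> max N1 N2" for m n
  proof (rule ccontr)
    assume *: "\<not> ?thesis"
    have X: "a k \<in> X" "a m \<in> X" "b n \<in> X" "b l \<in> X" using assms gseqs_in by auto
    have "R + 2 * \<delta> - \<delta> \<le> gp e (a k) (b n)"
      using * N1[of k m] that kl by (intro gp_ge[OF base X(1,2,3)]) auto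
    moreover have "R + \<delta> \<le> gp e (b n) (b l)" using N2[of n l] that kl delta_nonneg by simp
    ultimately have "R + \<delta> - \<delta> \<le> gp e (a k) (b l)"
      by (intro gp_ge[OF base X(1,3,4)]) auto
    then show False using kl by simp
  qed
  then show ?thesis by blast
qed

lemma bdry_iff: "\<xi> \<in> bdry \<longleftrightarrow> (\<exists>a\<in>gseqs. \<xi> = seq_class a)"
proof -
  have "{(a, b). a \<in> gseqs \<and> b \<in> gseqs \<and> products_diverge d e a b} `` {a} = seq_class a"
    if "a \<in> gseqs" for a using that by (auto simp: seq_class_def)
  then show ?thesis by (auto simp: gromov_boundary_def quotient_def)
qed

lemma seq_class_in_bdry: "a \<in> gseqs \<Longrightarrow> seq_class a \<in> bdry"
  using bdry_iff by blast

lemma self_in_seq_class: "a \<in> gseqs \<Longrightarrow> a \<in> seq_class a"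
  by (auto simp: seq_class_def gromov_sequences_def)

lemma bdry_subset: "\<xi> \<in> bdry \<Longrightarrow> \<xi> \<subseteq> gseqs"
  by (auto simp: bdry_iff seq_class_def)

lemma bdry_seq_in: "\<xi> \<in> bdry \<Longrightarrow> a \<in> \<xi> \<Longrightarrow> a n \<in> X"
  using bdry_subset gseqs_in by blast

lemma bdry_nonempty: "\<xi> \<in> bdry \<Longrightarrow> \<exists>a. a \<in> \<xi>"
  using bdry_iff self_in_seq_class by blast

lemma bdry_diverge:
  assumes "\<xi> \<in> bdry" "a \<in> \<xi>" "b \<in> \<xi>"
  shows "products_diverge d e a b"
proof -
  obtain c where c: "c \<in> gseqs" "\<xi> = seq_class c" using assms bdry_iff by blast
  have "products_diverge d e c a" "products_diverge d e c b" "a \<in> gseqs" "b \<in> gseqs"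
    using assms c by (auto simp: seq_class_def)
  moreover have "range a \<subseteq> X" "range b \<subseteq> X" "range c \<subseteq> X"
    using calculation c by (auto simp: gromov_sequences_def)
  ultimately show ?thesis using products_diverge_trans products_diverge_sym by blast
qed

lemma bdry_in:
  assumes "\<xi> \<in> bdry" "a \<in> \<xi>" "b \<in> gseqs" "products_diverge d e a b"
  shows "b \<in> \<xi>"
proof -
  obtain c where c: "c \<in> gseqs" "\<xi> = seq_class c" using assms bdry_iff by blast
  then have a: "products_diverge d e c a" "a \<in> gseqs" using assms by (auto simp: seq_class_def)
  then have "products_diverge d e c b"
    using assms c products_diverge_trans[of c a b] by (auto simp: gromov_sequences_def)
  then show ?thesis using c assms by (simp add: seq_class_def)
qed

lemma bdry_eq_seq_class: "\<xi> \<in> bdry \<Longrightarrow> a \<in> \<xi> \<Longrightarrow> \<xi> = seq_class a"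
  using bdry_in bdry_diverge bdry_subset unfolding seq_class_def by blast

section \<open>Products of boundary points\<close>

lemma bprod_ge:
  assumes "a \<in> A" "b \<in> B" "\<And>m n. m \<ge> N \<Longrightarrow> n \<ge> N \<Longrightarrow> R \<le> gp e (a m) (b n)"
  shows "ereal R \<le> bprod A B"
proof -
  have "ereal R \<le> Liminf (sequentially \<times>\<^sub>F sequentially) (\<lambda>(m, n). ereal (gp e (a m) (b n)))"
    by (rule Liminf_bounded) (use assms(3) in \<open>auto simp: eventually_prod_sequentially\<close>)
  also have "\<dots> \<le> bprod A B"
    unfolding boundary_product_def using assms by (intro SUP_upper2[of "(a, b)"]) auto
  finally show ?thesis .
qed

lemma bprod_gtE:
  assumes "ereal R < bprod A B"
  obtains a b N where "a \<in> A" "b \<in> B" "\<And>m n. m \<ge> N \<Longrightarrow> n \<ge> N \<Longrightarrow> R < gp e (a m) (b n)"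
proof -
  obtain a b where ab: "a \<in> A" "b \<in> B"
    "ereal R < Liminf (sequentially \<times>\<^sub>F sequentially) (\<lambda>(m, n). ereal (gp e (a m) (b n)))"
    using assms unfolding boundary_product_def less_SUP_iff by auto
  then have "\<forall>\<^sub>F (m, n) in sequentially \<times>\<^sub>F sequentially. ereal R < ereal (gp e (a m) (b n))"
    using less_LiminfD by (fastforce simp: case_prod_unfold)
  then obtain N where "\<And>m n. m \<ge> N \<Longrightarrow> n \<ge> N \<Longrightarrow> R < gp e (a m) (b n)"
    unfolding eventually_prod_sequentially prod.case ereal_less_eq less_ereal.simps by meson
  then show ?thesis using that ab by blast
qed

abbreviation "reps \<equiv> representatives :: 'x + (nat \<Rightarrow> 'x) set \<Rightarrow> _"

text \<open>The alternative \<open>a = b\<close> is for the points of \<open>X\<close>: their only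
  representative is a constant sequence, whose products with itself stay bounded.\<close>

lemma reps_close:
  assumes "p \<in> compactification X d e" "a \<in> reps p" "b \<in> reps p"
  shows "a = b \<or> products_diverge d e a b"
  using assms bdry_diverge by (auto simp: compactification_def)

lemma reps_in: "p \<in> compactification X d e \<Longrightarrow> a \<in> reps p \<Longrightarrow> a n \<in> X"
  using bdry_seq_in by (auto simp: compactification_def)

lemma reps_nonempty: "p \<in> compactification X d e \<Longrightarrow> \<exists>a. a \<in> reps p"
  using bdry_nonempty by (auto simp: compactification_def)

text \<open>The supremum provides some pair of representatives with large products. Replacing each
  of the two by the given one costs one \<open>\<delta>\<close>.\<close>

lemma bprod_gt_reps:
  assumes p: "p \<in> compactification X d e" and q: "q \<in> compactification X d e"
    and R: "ereal R < bprod (reps p) (reps q)" and a: "a \<in> reps p" and b: "b \<in> reps q"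
  shows "\<exists>N. \<forall>m\<ge>N. \<forall>n\<ge>N. R - 2 * \<delta> \<le> gp e (a m) (b n)"
proof -
  obtain a' b' N where ab: "a' \<in> reps p" "b' \<in> reps q"
    and N: "\<And>m n. m \<ge> N \<Longrightarrow> n \<ge> N \<Longrightarrow> R < gp e (a' m) (b' n)"
    using bprod_gtE[OF R] by blast
  note X = reps_in[OF p a] reps_in[OF p ab(1)] reps_in[OF q ab(2)] reps_in[OF q b]
  obtain N1 where N1: "\<And>m n. m \<ge> N1 \<Longrightarrow> n \<ge> N1 \<Longrightarrow> R - \<delta> \<le> gp e (a m) (b' n)"
  proof (cases "a = a'")
    case True
    have "R - \<delta> \<le> gp e (a m) (b' n)" if "m \<ge> N" "n \<ge> N" for m n
      using N[OF that] True delta_nonneg by simp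
    then show ?thesis using that by blast
  next
    case False
    then obtain K where K: "\<And>m n. m \<ge> K \<Longrightarrow> n \<ge> K \<Longrightarrow> R \<le> gp e (a m) (a' n)"
      using reps_close[OF p a ab(1)] unfolding products_diverge_iff by meson
    have "R - \<delta> \<le> gp e (a m) (b' n)" if "m \<ge> max K N" "n \<ge> max K N" for m n
      by (rule gp_ge[OF base X(1) X(2)[of "max K N"] X(3)])
        (use that K N[of "max K N" n] in \<open>auto intro: less_imp_le\<close>)
    then show ?thesis using that by blast
  qed
  show ?thesis
  proof (cases "b = b'")
    case True
    have "R - 2 * \<delta> \<le> gp e (a m) (b n)" if "m \<ge> N1" "n \<ge> N1" for m n
      using N1[OF that] True delta_nonneg by simp
    then show ?thesis by blast
  next
    case False
    then obtain K where K: "\<And>m n. m \<ge> K \<Longrightarrow> n \<ge> K \<Longrightarrow> R - \<delta> \<le> gp e (b' m) (b n)"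
      using reps_close[OF q ab(2) b] unfolding products_diverge_iff by meson
    have "R - \<delta> - \<delta> \<le> gp e (a m) (b n)" if "m \<ge> max K N1" "n \<ge> max K N1" for m n
      by (rule gp_ge[OF base X(1) X(3)[of "max K N1"] X(4)])
        (use that K N1[of m "max K N1"] in auto)
    then show ?thesis by (auto intro!: exI[of _ "max K N1"])
  qed
qed

text \<open>The term \<open>2 * \<delta>\<close> pays for the change of representatives in
  \<open>bprod_gt_reps\<close>; the \<open>1\<close> leaves a contradiction between two non-strict
  bounds.\<close>

lemma bprod_le:
  assumes a: "a \<in> gseqs" and b: "b \<in> gseqs"
    and C: "\<And>m n. m \<ge> N \<Longrightarrow> n \<ge> N \<Longrightarrow> gp e (a m) (b n) \<le> C"
  shows "bprod (seq_class a) (seq_class b) \<le> ereal (C + 2 * \<delta> + 1)"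
proof (rule ccontr)
  assume "\<not> ?thesis"
  then have "ereal (C + 2 * \<delta> + 1) < bprod (reps (Inr (seq_class a))) (reps (Inr (seq_class b)))"
    by simp
  from bprod_gt_reps[OF _ _ this] obtain K where
    "\<And>m n. m \<ge> K \<Longrightarrow> n \<ge> K \<Longrightarrow> C + 1 \<le> gp e (a m) (b n)"
    using a b by (fastforce simp: compactification_def seq_class_in_bdry self_in_seq_class)
  from this[of "max K N" "max K N"] C[of "max K N" "max K N"] show False by simp
qed

text \<open>Passing to one common representative of \<open>\<theta>\<close> costs
  \<open>2 * \<delta>\<close>, and the four-point inequality through its far terms costs the third
  \<open>\<delta>\<close>.\<close>

lemma bprod_chain:
  assumes p: "p \<in> compactification X d e" and \<theta>: "\<theta> \<in> bdry" and \<zeta>: "\<zeta> \<in> bdry"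
    and "ereal R < bprod (reps p) \<theta>" "ereal R < bprod \<theta> \<zeta>"
  shows "ereal (R - 3 * \<delta>) \<le> bprod (reps p) \<zeta>"
proof -
  obtain a b c where a: "a \<in> reps p" and b: "b \<in> \<theta>" and c: "c \<in> \<zeta>"
    using reps_nonempty[OF p] bdry_nonempty \<theta> \<zeta> by blast
  have in_comp: "Inr \<theta> \<in> compactification X d e" "Inr \<zeta> \<in> compactification X d e"
    using \<theta> \<zeta> by (auto simp: compactification_def)
  obtain N1 where N1: "\<And>m n. m \<ge> N1 \<Longrightarrow> n \<ge> N1 \<Longrightarrow> R - 2 * \<delta> \<le> gp e (a m) (b n)"
    using bprod_gt_reps[OF p in_comp(1) _ a, of R b] assms b by (simp) meson
  obtain N2 where N2: "\<And>m n. m \<ge> N2 \<Longrightarrow> n \<ge> N2 \<Longrightarrow> R - 2 * \<delta> \<le> gp e (b m) (c n)"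
    using bprod_gt_reps[OF in_comp, of R b c] assms b c by (simp) meson
  have "R - 2 * \<delta> - \<delta> \<le> gp e (a m) (c n)" if "m \<ge> max N1 N2" "n \<ge> max N1 N2" for m n
    using that N1[of m "max N1 N2"] N2[of "max N1 N2" n]
      reps_in[OF p a] reps_in[OF in_comp(1)] reps_in[OF in_comp(2)] b c
    by (intro gp_ge[OF base, of _ "b (max N1 N2)"]) auto
  then show ?thesis using bprod_ge[OF a c, of "max N1 N2" "R - 3 * \<delta>"] by simp
qed

section \<open>Convergence in the compactification\<close>

lemma openin_singleton_Inl:
  "x \<in> X \<Longrightarrow> openin (compactification_topology X d e) {Inl x}"
  by (simp add: openin_compactification_topology compactification_open_def compactification_def)

lemma limitin_boundary_point:
  assumes "\<xi> \<in> bdry" "a \<in> \<xi>"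
  shows "limitin (compactification_topology X d e) (\<lambda>n. Inl (a n)) (Inr \<xi>) sequentially"
  unfolding limitin_def
proof (intro conjI allI impI)
  show "Inr \<xi> \<in> topspace (compactification_topology X d e)"
    using assms by (simp add: compactification_def)
  fix U assume "openin (compactification_topology X d e) U \<and> Inr \<xi> \<in> U"
  then obtain R :: real where R: "\<And>p. p \<in> compactification X d e \<Longrightarrow> ereal R < bprod (reps p) \<xi> \<Longrightarrow> p \<in> U"
    unfolding openin_compactification_topology compactification_open_def by blast
  obtain N where N: "\<And>m n. m \<ge> N \<Longrightarrow> n \<ge> N \<Longrightarrow> R + 1 \<le> gp e (a m) (a n)"
    using bdry_diverge[OF assms assms(2)] unfolding products_diverge_iff by meson
  have "Inl (a n) \<in> U" if "n \<ge> N" for n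
  proof (rule R)
    show "Inl (a n) \<in> compactification X d e"
      using assms bdry_seq_in by (auto simp: compactification_def)
    have "ereal (R + 1) \<le> bprod (reps (Inl (a n))) \<xi>"
      by (rule bprod_ge[OF _ assms(2), of "\<lambda>_. a n" _ N]) (simp_all add: N that)
    then show "ereal R < bprod (reps (Inl (a n))) \<xi>"
      by (metis dual_order.strict_trans1 ereal_less(2) less_add_one less_ereal.simps(1))
  qed
  then show "\<forall>\<^sub>F n in sequentially. Inl (a n) \<in> U"
    unfolding eventually_sequentially by blast
qed

text \<open>
  The sets \<open>{p. R < (p \<cdot> \<xi>)}\<close> need not be open, but each contains an open neighbourhood of \<open>\<xi>\<close>:
  the points of \<open>X\<close> in it together with the boundary points it is a neighbourhood of.
\<close>

lemma boundary_point_nbhd: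
  assumes "\<xi> \<in> bdry"
  obtains V where "openin (compactification_topology X d e) V" "Inr \<xi> \<in> V"
    "\<And>x. Inl x \<in> V \<Longrightarrow> x \<in> X \<and> ereal R < bprod {\<lambda>_. x} \<xi>"
proof -
  define U where "U = {p \<in> compactification X d e. ereal R < bprod (reps p) \<xi>}"
  define W where "W = {\<zeta> \<in> bdry. \<exists>R'::real. \<forall>q\<in>compactification X d e. ereal R' < bprod (reps q) \<zeta> \<longrightarrow> q \<in> U}"
  define V where "V = {p \<in> U. isl p} \<union> Inr ` W"
  have "\<exists>R''::real. \<forall>q\<in>compactification X d e. ereal R'' < bprod (reps q) \<zeta> \<longrightarrow> q \<in> V"
    if in_W: "\<zeta> \<in> W" for \<zeta>
  proof -
    obtain R' :: real where \<zeta>: "\<zeta> \<in> bdry"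
      and R': "\<And>q. q \<in> compactification X d e \<Longrightarrow> ereal R' < bprod (reps q) \<zeta> \<Longrightarrow> q \<in> U"
      using in_W unfolding W_def by blast
    \<comment> \<open>The loss in \<open>bprod_chain\<close> is \<open>3 * \<delta>\<close>; the
      \<open>1\<close> makes the resulting inequality strict.\<close>
    define R'' where "R'' = R' + 3 * \<delta> + 1"
    have gt: "ereal R' < t" if "ereal (R'' - 3 * \<delta>) \<le> t" for t
      using that unfolding R''_def by (rule less_le_trans[rotated]) simp
    have "q \<in> V" if q: "q \<in> compactification X d e" "ereal R'' < bprod (reps q) \<zeta>" for q
    proof (cases q)
      case (Inl x)
      have "ereal R' < bprod (reps q) \<zeta>"
        using q(2) by (rule le_less_trans[rotated]) (use delta_nonneg in \<open>simp add: R''_def\<close>)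
      then show ?thesis using R' q Inl by (simp add: V_def)
    next
      case (Inr \<theta>)
      then have \<theta>: "\<theta> \<in> bdry" using q by (auto simp: compactification_def)
      \<comment> \<open>This puts \<open>\<theta>\<close> into \<open>W\<close>, with the same
        radius \<open>R''\<close> as witness.\<close>
      have "w \<in> U" if w: "w \<in> compactification X d e" "ereal R'' < bprod (reps w) \<theta>" for w
        using R'[OF w(1)] gt bprod_chain[OF w(1) \<theta> \<zeta> w(2)] q(2) Inr by simp
      then show ?thesis using Inr \<theta> by (auto simp: V_def W_def)
    qed
    then show ?thesis by blast
  qed
  then have "openin (compactification_topology X d e) V"
    unfolding openin_compactification_topology compactification_open_def
    by (auto simp: V_def U_def W_def compactification_def)
  moreover have "Inr \<xi> \<in> V" using assms by (auto simp: V_def W_def U_def)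
  moreover have "x \<in> X \<and> ereal R < bprod {\<lambda>_. x} \<xi>" if "Inl x \<in> V" for x
    using that by (auto simp: V_def U_def compactification_def)
  ultimately show ?thesis using that by blast
qed

text \<open>Neighbourhoods of \<open>\<xi>\<close> compare each late \<open>a n\<close> with the
  tail of a representative \<open>b\<close>. A far term of \<open>b\<close> then serves as
  intermediate point, first between two terms of \<open>a\<close>, then between terms of
  \<open>b\<close> and \<open>a\<close>.\<close>

lemma limitin_boundary_pointD:
  assumes \<xi>: "\<xi> \<in> bdry"
    and lim: "limitin (compactification_topology X d e) (\<lambda>n. Inl (a n)) (Inr \<xi>) sequentially"
    and aX: "range a \<subseteq> X"
  shows "a \<in> \<xi>"
proof -
  obtain b where b: "b \<in> \<xi>" "b \<in> gseqs" using \<xi> bdry_nonempty bdry_subset by blast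
  have bX: "b n \<in> X" for n using b gseqs_in by blast
  have aX': "a n \<in> X" for n using aX by blast
  \<comment> \<open>The threshold \<open>K\<close> may depend on \<open>n\<close>, because the
    neighbourhood only sees the constant sequence at \<open>a n\<close>; this is not yet joint
    divergence.\<close>
  have ev: "\<exists>M. \<forall>n\<ge>M. \<exists>K. \<forall>k\<ge>K. R \<le> gp e (a n) (b k)" for R
  proof -
    obtain V where V: "openin (compactification_topology X d e) V" "Inr \<xi> \<in> V"
      "\<And>x. Inl x \<in> V \<Longrightarrow> x \<in> X \<and> ereal (R + 2 * \<delta>) < bprod {\<lambda>_. x} \<xi>"
      using boundary_point_nbhd[OF \<xi>, of "R + 2 * \<delta>"] by blast
    obtain M where M: "\<And>n. n \<ge> M \<Longrightarrow> Inl (a n) \<in> V"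
      using lim V unfolding limitin_def eventually_sequentially by blast
    have "\<exists>K. \<forall>k\<ge>K. R \<le> gp e (a n) (b k)" if "n \<ge> M" for n
      using bprod_gt_reps[of "Inl (a n)" "Inr \<xi>" "R + 2 * \<delta>" "\<lambda>_. a n" b] V(3)[OF M[OF that]] \<xi> b
      by (auto simp: compactification_def)
    then show ?thesis by blast
  qed
  have "\<exists>N. \<forall>m\<ge>N. \<forall>n\<ge>N. R \<le> gp e (a m) (a n)" for R
  proof -
    obtain M where M: "\<And>n. n \<ge> M \<Longrightarrow> \<exists>K. \<forall>k\<ge>K. R + \<delta> \<le> gp e (a n) (b k)" using ev by blast
    have "R \<le> gp e (a m) (a n)" if "m \<ge> M" "n \<ge> M" for m n
    proof -
      obtain K1 K2 where "\<forall>k\<ge>K1. R + \<delta> \<le> gp e (a m) (b k)" "\<forall>k\<ge>K2. R + \<delta> \<le> gp e (a n) (b k)"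
        using M \<open>m \<ge> M\<close> \<open>n \<ge> M\<close> by blast
      then have "R + \<delta> \<le> gp e (a m) (b (max K1 K2))" "R + \<delta> \<le> gp e (b (max K1 K2)) (a n)"
        using gp_commute aX' bX by simp_all
      then show ?thesis using gp_ge[OF base aX' bX aX'] by fastforce
    qed
    then show ?thesis by blast
  qed
  then have ag: "a \<in> gseqs" using aX by (simp add: gromov_sequences_def products_diverge_iff)
  have "\<exists>N. \<forall>m\<ge>N. \<forall>n\<ge>N. R \<le> gp e (b m) (a n)" for R
  proof -
    obtain M where M: "\<And>n. n \<ge> M \<Longrightarrow> \<exists>K. \<forall>k\<ge>K. R + \<delta> \<le> gp e (a n) (b k)" using ev by blast
    obtain L where L: "\<And>m n. m \<ge> L \<Longrightarrow> n \<ge> L \<Longrightarrow> R + \<delta> \<le> gp e (b m) (b n)"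
      using bdry_diverge[OF \<xi> b(1) b(1)] unfolding products_diverge_iff by meson
    have "R \<le> gp e (b m) (a n)" if "m \<ge> max L M" "n \<ge> max L M" for m n
    proof -
      obtain K where "\<forall>k\<ge>K. R + \<delta> \<le> gp e (a n) (b k)" using M[of n] \<open>n \<ge> max L M\<close> by auto
      then have "R + \<delta> \<le> gp e (b (max K L)) (a n)" using gp_commute aX' bX by simp
      moreover have "R + \<delta> \<le> gp e (b m) (b (max K L))" using L that by simp
      ultimately show ?thesis using gp_ge[OF base bX bX aX'] by fastforce
    qed
    then show ?thesis by blast
  qed
  then show ?thesis using bdry_in[OF \<xi> b(1) ag] by (simp add: products_diverge_iff)
qed

text \<open>Points of \<open>X\<close> are isolated, so the sequence would be eventually constant
  and its products with itself bounded.\<close>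

lemma not_limitin_Inl:
  assumes "a \<in> gseqs"
  shows "\<not> limitin (compactification_topology X d e) (\<lambda>n. Inl (a n)) (Inl x) sequentially"
proof
  assume lim: "limitin (compactification_topology X d e) (\<lambda>n. Inl (a n)) (Inl x) sequentially"
  then have x: "x \<in> X" using limitin_topspace[OF lim] by (auto simp: compactification_def)
  obtain M where M: "\<And>n. n \<ge> M \<Longrightarrow> a n = x"
    using lim openin_singleton_Inl[OF x] unfolding limitin_def eventually_sequentially by blast
  obtain N where N: "\<And>m n. m \<ge> N \<Longrightarrow> n \<ge> N \<Longrightarrow> gp e x x + 1 \<le> gp e (a m) (a n)"
    using gseqs_diverge[OF assms] unfolding products_diverge_iff by meson
  show False using N[of "max M N" "max M N"] M by simp
qed

text \<open>A point \<open>g\<close> cannot be close to two separated boundary points: large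
  products of \<open>g\<close> with both sequences would give, through \<open>g\<close>, a large
  product between them.\<close>

lemma bounded_product_alternative:
  assumes a: "a \<in> gseqs" and b: "b \<in> gseqs"
    and C: "\<And>m n. m \<ge> N \<Longrightarrow> n \<ge> N \<Longrightarrow> gp e (a m) (b n) \<le> C" and g: "g \<in> X"
  shows "(\<exists>K. \<forall>m\<ge>K. gp e g (a m) \<le> C + 2 * \<delta> + 1) \<or> (\<exists>K. \<forall>m\<ge>K. gp e g (b m) \<le> C + 2 * \<delta> + 1)"
proof (rule ccontr)
  assume "\<not> ?thesis"
  then have fa: "\<And>K. \<exists>m\<ge>K. C + 2 * \<delta> + 1 < gp e g (a m)"
    and fb: "\<And>K. \<exists>m\<ge>K. C + 2 * \<delta> + 1 < gp e g (b m)" by (meson not_le)+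
  obtain m where m: "m \<ge> N" "C + 2 * \<delta> + 1 < gp e g (a m)" using fa by blast
  obtain n where n: "n \<ge> N" "C + 2 * \<delta> + 1 < gp e g (b n)" using fb by blast
  have "C + 2 * \<delta> + 1 - \<delta> \<le> gp e (a m) (b n)"
    using m n a b g gseqs_in gp_commute by (intro gp_ge[OF base, of _ g]) (auto intro: less_imp_le)
  then show False using C[OF m(1) n(1)] delta_nonneg by linarith
qed

end

section \<open>Hyperbolic groups\<close>

locale hyp_group = fg_group G S for G (structure) and S +
  fixes \<delta> :: real
  assumes four_point_wdist: "\<And>w x y z. w \<in> carrier G \<Longrightarrow> x \<in> carrier G \<Longrightarrow> y \<in> carrier G \<Longrightarrow> z \<in> carrier G \<Longrightarrow>
    min (gromov_product (\<lambda>x y. real (word_dist G S x y)) w x y)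
        (gromov_product (\<lambda>x y. real (word_dist G S x y)) w y z) - \<delta>
    \<le> gromov_product (\<lambda>x y. real (word_dist G S x y)) w x z"

sublocale hyp_group \<subseteq> hyperbolic_space "carrier G" "\<lambda>x y. real (word_dist G S x y)" "\<one>" \<delta>
  by standard (auto simp: wdist_commute wdist_self four_point_wdist)

lemma hyperbolic_group_hyp_group:
  assumes "hyperbolic_group G S"
  obtains \<delta> where "hyp_group G S \<delta>"
proof -
  interpret fg_group G S
    using assms by (simp add: hyperbolic_group_def fg_group_def fg_group_axioms_def)
  show ?thesis
    using assms that fg_group_axioms unfolding hyperbolic_group_def gromov_hyperbolic_def hyp_group_def hyp_group_axioms_def
    by blast
qed

context hyp_group
begin

section \<open>Left translation and Gromov products\<close>

abbreviation "pdiv \<equiv> products_diverge (\<lambda>x y. real (word_dist G S x y)) \<one>"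

lemma gp_one:
  assumes "x \<in> carrier G" "y \<in> carrier G"
  shows "gp \<one> x y = (real (wlen x) + real (wlen y) - real (wdist x y)) / 2"
  using assms by (simp add: gromov_product_def)

lemma wlen_translate:
  assumes "h \<in> carrier G" "x \<in> carrier G"
  shows "wlen (h \<otimes> x) \<le> wlen h + wlen x" "wlen x \<le> wlen h + wlen (h \<otimes> x)"
  using wlen_mult[of h x] wlen_mult[of "inv h" "h \<otimes> x"] assms by (simp_all add: m_assoc[symmetric])

text \<open>Left translation preserves \<open>wdist\<close>, so only the two distances to
  \<open>\<one>\<close> change, each by at most \<open>wlen h\<close>; halving their sum leaves one
  \<open>wlen h\<close>.\<close>

lemma gp_translate_ge:
  assumes "h \<in> carrier G" "x \<in> carrier G" "y \<in> carrier G"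
  shows "gp \<one> x y - wlen h \<le> gp \<one> (h \<otimes> x) (h \<otimes> y)"
proof -
  have "real (wlen (h \<otimes> x)) \<le> wlen h + real (wlen x)" "real (wlen x) \<le> wlen h + real (wlen (h \<otimes> x))"
    "real (wlen (h \<otimes> y)) \<le> wlen h + real (wlen y)" "real (wlen y) \<le> wlen h + real (wlen (h \<otimes> y))"
    using wlen_translate[OF assms(1,2)] wlen_translate[OF assms(1,3)] by linarith+
  then show ?thesis using assms by (simp add: gp_one wdist_translate field_simps)
qed

lemma gp_translate_le:
  assumes "h \<in> carrier G" "x \<in> carrier G" "y \<in> carrier G"
  shows "gp \<one> (h \<otimes> x) (h \<otimes> y) \<le> gp \<one> x y + wlen h"
proof -
  have "real (wlen (h \<otimes> x)) \<le> wlen h + real (wlen x)" "real (wlen x) \<le> wlen h + real (wlen (h \<otimes> x))"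
    "real (wlen (h \<otimes> y)) \<le> wlen h + real (wlen y)" "real (wlen y) \<le> wlen h + real (wlen (h \<otimes> y))"
    using wlen_translate[OF assms(1,2)] wlen_translate[OF assms(1,3)] by linarith+
  then show ?thesis using assms by (simp add: gp_one wdist_translate field_simps)
qed

lemma wdist_inv: "h \<in> carrier G \<Longrightarrow> x \<in> carrier G \<Longrightarrow> wdist (inv h) x = wlen (h \<otimes> x)"
  by (simp add: word_dist_def)

text \<open>This identity describes the shadow of \<open>h\<close>: the product of
  \<open>h \<otimes> x\<close> with \<open>h\<close> is nearly \<open>wlen h\<close> precisely when
  \<open>x\<close> is not close to \<open>inv h\<close>.\<close>

lemma gp_translate_self:
  assumes "h \<in> carrier G" "x \<in> carrier G"
  shows "gp \<one> (h \<otimes> x) h = wlen h - gp \<one> (inv h) x"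
  using assms wdist_translate[of h x \<one>] by (simp add: gp_one wdist_inv field_simps)

lemma pdiv_translate:
  assumes h: "h \<in> carrier G" and "range a \<subseteq> carrier G" "range b \<subseteq> carrier G" and ab: "pdiv a b"
  shows "pdiv (\<lambda>n. h \<otimes> a n) (\<lambda>n. h \<otimes> b n)"
  unfolding products_diverge_iff
proof
  fix R :: real
  obtain N where N: "\<And>m n. m \<ge> N \<Longrightarrow> n \<ge> N \<Longrightarrow> R + wlen h \<le> gp \<one> (a m) (b n)"
    using ab unfolding products_diverge_iff by meson
  have "R \<le> gp \<one> (h \<otimes> a m) (h \<otimes> b n)" if "m \<ge> N" "n \<ge> N" for m n
    using N[OF that] gp_translate_ge[OF h, of "a m" "b n"] assms by (simp add: image_subset_iff)
  then show "\<exists>N. \<forall>m\<ge>N. \<forall>n\<ge>N. R \<le> gp \<one> (h \<otimes> a m) (h \<otimes> b n)" by blast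
qed

lemma gseqs_translate:
  assumes "h \<in> carrier G" "a \<in> gseqs"
  shows "(\<lambda>n. h \<otimes> a n) \<in> gseqs"
  using assms pdiv_translate[of h a a] by (auto simp: gromov_sequences_def)

text \<open>By \<open>gp_translate_self\<close>, both translated sequences end up in the shadow of
  \<open>h\<close>; the four-point inequality through \<open>h\<close> compares them.\<close>

lemma bprod_translate_ge:
  fixes C :: real
  assumes h: "h \<in> carrier G" and a: "a \<in> gseqs" and b: "b \<in> gseqs"
    and Ka: "\<And>m. m \<ge> K \<Longrightarrow> gp \<one> (inv h) (a m) \<le> C"
    and Kb: "\<And>m. m \<ge> K' \<Longrightarrow> gp \<one> (inv h) (b m) \<le> C"
  shows "ereal (wlen h - C - \<delta>) \<le> bprod (seq_class (\<lambda>n. h \<otimes> a n)) (seq_class (\<lambda>n. h \<otimes> b n))"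
proof (rule bprod_ge[OF self_in_seq_class self_in_seq_class])
  show "(\<lambda>n. h \<otimes> a n) \<in> gseqs" "(\<lambda>n. h \<otimes> b n) \<in> gseqs"
    using gseqs_translate a b h by blast+
  fix m n assume mn: "max K K' \<le> m" "max K K' \<le> n"
  have X: "a m \<in> carrier G" "b n \<in> carrier G" using a b gseqs_in by blast+
  have "wlen h - C \<le> gp \<one> (h \<otimes> a m) h" "wlen h - C \<le> gp \<one> h (h \<otimes> b n)"
    using gp_translate_self[OF h] gp_commute[OF h] Ka Kb X h mn by simp_all
  then show "wlen h - C - \<delta> \<le> gp \<one> (h \<otimes> a m) (h \<otimes> b n)"
    using X h by (intro gp_ge[where y = h]) auto
qed

lemma bprod_translate_le:
  fixes C :: real
  assumes h: "h \<in> carrier G" and a: "a \<in> gseqs" and b: "b \<in> gseqs"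
    and C: "\<And>m n. m \<ge> N \<Longrightarrow> n \<ge> N \<Longrightarrow> gp \<one> (a m) (b n) \<le> C"
  shows "bprod (seq_class (\<lambda>n. h \<otimes> a n)) (seq_class (\<lambda>n. h \<otimes> b n)) \<le> ereal (C + wlen h + 2 * \<delta> + 1)"
proof (rule bprod_le)
  show "(\<lambda>n. h \<otimes> a n) \<in> gseqs" "(\<lambda>n. h \<otimes> b n) \<in> gseqs"
    using gseqs_translate a b h by blast+
  fix m n assume "N \<le> m" "N \<le> n"
  then show "gp \<one> (h \<otimes> a m) (h \<otimes> b n) \<le> C + wlen h"
    using gp_translate_le[OF h gseqs_in[OF a] gseqs_in[OF b], of m n] C[of m n] by simp
qed

text \<open>Along a geodesic ray from \<open>\<one>\<close> the product of the terms
  \<open>m\<close> and \<open>n\<close> is \<open>min m n\<close>.\<close>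

lemma ex_gromov_sequence:
  assumes "infinite (carrier G)"
  shows "\<exists>a. a \<in> gseqs"
proof -
  obtain \<gamma> where \<gamma>: "range \<gamma> \<subseteq> carrier G" "\<And>m n. m \<le> n \<Longrightarrow> wdist (\<gamma> m) (\<gamma> n) = n - m" "\<gamma> 0 = \<one>"
    using ex_geodesic_ray[OF assms] by blast
  have c: "\<gamma> n \<in> carrier G" for n using \<gamma> by blast
  have len: "wlen (\<gamma> n) = n" for n using \<gamma>(2)[of 0 n] \<gamma>(3) c by simp
  have gp: "gp \<one> (\<gamma> m) (\<gamma> n) = min m n" for m n
  proof (cases "m \<le> n")
    case True
    then show ?thesis using \<gamma>(2)[of m n] by (simp add: gp_one c len of_nat_diff)
  next
    case False
    then show ?thesis using \<gamma>(2)[of n m] wdist_commute[OF c c, of m n] by (simp add: gp_one c len of_nat_diff)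
  qed
  have "pdiv \<gamma> \<gamma>"
    unfolding products_diverge_iff gp
  proof
    fix R :: real
    obtain N where "R \<le> real N" using real_arch_simple by blast
    then show "\<exists>N. \<forall>m\<ge>N. \<forall>n\<ge>N. R \<le> real (min m n)" by (intro exI[of _ N]) auto
  qed
  then show ?thesis using \<gamma>(1) by (auto simp: gromov_sequences_def)
qed

text \<open>
  If every \<open>h \<in> A\<close> fixes the boundary point of \<open>a\<close>, then a point \<open>g\<close> far out on a geodesic towards
  it is moved by each \<open>h \<in> A\<close> to a point determined, up to bounded error, by its distance from \<open>\<one>\<close>.
  Conjugation by \<open>g\<close> therefore sends the quotients of elements of \<open>A\<close> with equal such distance into a fixed ball.
\<close>

lemma card_stabilizer_le:
  assumes a: "a \<in> gseqs" and A: "finite A" "A \<subseteq> carrier G"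
    and len: "\<And>h. h \<in> A \<Longrightarrow> wlen h \<le> n" and stab: "\<And>h. h \<in> A \<Longrightarrow> pdiv (\<lambda>m. h \<otimes> a m) a"
  shows "card A \<le> (2 * n + 1) * card {g \<in> carrier G. wlen g \<le> nat \<lceil>6 * \<delta>\<rceil>}"
proof -
  \<comment> \<open>\<open>N\<close> exceeds \<open>n + \<delta>\<close>, so that seen from a point
    \<open>g\<close> of length \<open>N\<close> every \<open>inv h\<close> lies in the direction of
    \<open>\<one>\<close>. \<open>R\<close> bounds the length of every
    \<open>h \<otimes> g\<close>.\<close>
  define N where "N = n + nat \<lceil>\<delta>\<rceil> + 1"
  define R where "R = real (N + n)"
  have N\<delta>: "real n + \<delta> < real N" unfolding N_def by linarith
  have "\<forall>h. \<exists>M. h \<in> A \<longrightarrow> (\<forall>m\<ge>M. R \<le> gp \<one> (h \<otimes> a m) (a m))"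
    using stab unfolding products_diverge_iff by meson
  then obtain M where M: "\<And>h m. h \<in> A \<Longrightarrow> m \<ge> M h \<Longrightarrow> R \<le> gp \<one> (h \<otimes> a m) (a m)" by metis
  obtain M0 where M0: "\<And>m. m \<ge> M0 \<Longrightarrow> R \<le> gp \<one> (a m) (a m)"
    using gseqs_diverge[OF a] unfolding products_diverge_iff by meson
  \<comment> \<open>As \<open>A\<close> is finite, one term of \<open>a\<close> is far enough out
    for all of its elements at once.\<close>
  define x where "x = a (Max (insert M0 (M ` A)))"
  have x: "x \<in> carrier G" unfolding x_def using a gseqs_in by blast
  have "R \<le> gp \<one> x x" unfolding x_def using A by (intro M0 Max_ge) auto
  then have "N \<le> wlen x" using x by (simp add: gp_one wdist_self R_def)
  then obtain g where g: "g \<in> carrier G" "wlen g = N" "wdist g x + N = wlen x"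
    using geodesic_point[OF x] by blast
  have hx: "R \<le> gp \<one> (h \<otimes> x) x" if "h \<in> A" for h
    unfolding x_def using A that by (intro M Max_ge) auto
  have hg: "gp \<one> (h \<otimes> g) x \<ge> wlen (h \<otimes> g) - 2 * \<delta>" if hA: "h \<in> A" for h
  proof -
    have h: "h \<in> carrier G" "wlen h \<le> n" using that A len by auto
    note tr = wlen_translate[OF h(1) g(1)]
    have ex: "gp g \<one> x = 0"
      using g x by (simp add: gromov_product_def wdist_commute[OF x])
    have hinv: "gp g \<one> (inv h) = gp g (inv h) \<one>" using gp_commute h by simp
    \<comment> \<open>Seen from \<open>g\<close>, the points \<open>\<one>\<close> and
      \<open>x\<close> are in opposite directions and \<open>inv h\<close> is on the side of
      \<open>\<one>\<close>, so its product with \<open>x\<close> is at most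
      \<open>\<delta>\<close>. Translated by \<open>h\<close>, this says that
      \<open>h \<otimes> g\<close> is nearly on a geodesic from \<open>\<one>\<close> to
      \<open>h \<otimes> x\<close>.\<close>
    have "gp g (inv h) \<one> > \<delta>"
      using N\<delta> tr g h by (simp add: gromov_product_def wdist_inv)
    moreover have "min (gp g \<one> (inv h)) (gp g (inv h) x) - \<delta> \<le> 0"
      using four_point_wdist[of g \<one> "inv h" x] ex g h x by simp
    ultimately have "gp g (inv h) x \<le> \<delta>" using hinv by linarith
    then have "gp \<one> (h \<otimes> g) (h \<otimes> x) \<ge> wlen (h \<otimes> g) - \<delta>"
      using h g x by (simp add: gromov_product_def wdist_inv wdist_commute[OF x] wdist_translate)
    moreover have "gp \<one> (h \<otimes> x) x \<ge> wlen (h \<otimes> g) - \<delta>"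
      using hx[OF hA] tr g h delta_nonneg unfolding R_def by linarith
    ultimately have "wlen (h \<otimes> g) - \<delta> - \<delta> \<le> gp \<one> (h \<otimes> g) x"
      using h g x by - (rule gp_ge[where y = "h \<otimes> x"]; simp)
    then show ?thesis by simp
  qed
  \<comment> \<open>Both points have almost maximal product with \<open>x\<close>, hence with each
    other up to \<open>3 * \<delta>\<close>. At equal length the distance is twice this
    defect.\<close>
  have close: "wdist (h \<otimes> g) (h' \<otimes> g) \<le> nat \<lceil>6 * \<delta>\<rceil>"
    if hh: "h \<in> A" "h' \<in> A" "wlen (h \<otimes> g) = wlen (h' \<otimes> g)" for h h'
  proof -
    have X: "h \<otimes> g \<in> carrier G" "h' \<otimes> g \<in> carrier G" using hh A g by auto
    have "wlen (h \<otimes> g) - 2 * \<delta> - \<delta> \<le> gp \<one> (h \<otimes> g) (h' \<otimes> g)"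
      by (rule gp_ge[where y = x])
        (use hg[OF hh(1)] hg[OF hh(2)] hh(3) X x gp_commute[OF x X(2)] in auto)
    then have "real (wdist (h \<otimes> g) (h' \<otimes> g)) \<le> 6 * \<delta>"
      using X hh(3) by (simp add: gp_one)
    then show ?thesis by linarith
  qed
  let ?B = "{g \<in> carrier G. wlen g \<le> nat \<lceil>6 * \<delta>\<rceil>}"
  have fiber: "card {h \<in> A. wlen (h \<otimes> g) = k} \<le> card ?B" for k
  proof (cases "{h \<in> A. wlen (h \<otimes> g) = k} = {}")
    case True
    then show ?thesis by (metis card.empty le0)
  next
    case False
    then obtain h0 where h0: "h0 \<in> A" "wlen (h0 \<otimes> g) = k" by blast
    show ?thesis
    proof (rule card_inj_on_le[of "\<lambda>h. inv (h0 \<otimes> g) \<otimes> (h \<otimes> g)"])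
      show "inj_on (\<lambda>h. inv (h0 \<otimes> g) \<otimes> (h \<otimes> g)) {h \<in> A. wlen (h \<otimes> g) = k}"
        using A h0 g by (auto simp: inj_on_def subset_iff)
      show "(\<lambda>h. inv (h0 \<otimes> g) \<otimes> (h \<otimes> g)) ` {h \<in> A. wlen (h \<otimes> g) = k} \<subseteq> ?B"
        using A h0 g close[OF h0(1)] by (auto simp: word_dist_def subset_iff)
    qed (rule finite_wlen_ball)
  qed
  \<comment> \<open>Since \<open>n < N\<close>, the subtraction is not truncated and the interval
    has exactly \<open>2 * n + 1\<close> elements.\<close>
  have "A \<subseteq> (\<Union>k\<in>{N - n..N + n}. {h \<in> A. wlen (h \<otimes> g) = k})"
  proof
    fix h assume h: "h \<in> A"
    then have "N - n \<le> wlen (h \<otimes> g)" "wlen (h \<otimes> g) \<le> N + n"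
      using wlen_translate[of h g] len[OF h] A g by auto
    then show "h \<in> (\<Union>k\<in>{N - n..N + n}. {h \<in> A. wlen (h \<otimes> g) = k})" using h by auto
  qed
  then have "card A \<le> card (\<Union>k\<in>{N - n..N + n}. {h \<in> A. wlen (h \<otimes> g) = k})"
    using A by (intro card_mono) auto
  also have "\<dots> \<le> (\<Sum>k\<in>{N - n..N + n}. card {h \<in> A. wlen (h \<otimes> g) = k})"
    by (rule card_UN_le) simp
  also have "\<dots> \<le> (\<Sum>k\<in>{N - n..N + n}. card ?B)" by (intro sum_mono fiber)
  also have "\<dots> = (2 * n + 1) * card ?B" by (simp add: N_def)
  finally show ?thesis .
qed

end

section \<open>Growth of non-elementary subgroups\<close>

text \<open>The positive words of length \<open>k\<close> in two free generators are
  \<open>2 ^ k\<close> distinct elements. Length is measured in \<open>G\<close> rather than in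
  \<open>H\<close>, to be compared with \<open>card_stabilizer_le\<close>.\<close>

lemma (in fg_group) exponential_growth:
  assumes H: "subgroup H G" and ne: "non_elementary (G\<lparr>carrier := H\<rparr>)"
  shows "\<exists>M. \<forall>k. \<exists>A\<subseteq>H. card A = 2 ^ k \<and> (\<forall>h\<in>A. wlen h \<le> M * k)"
proof -
  let ?F = "free_group (UNIV :: bool set)"
  obtain K where K: "subgroup K (G\<lparr>carrier := H\<rparr>)" "?F \<cong> G\<lparr>carrier := K\<rparr>"
    using ne by (auto simp: non_elementary_def)
  then obtain \<phi> where iso: "\<phi> \<in> iso ?F (G\<lparr>carrier := K\<rparr>)" by (auto simp: is_iso_def)
  have KH: "K \<subseteq> H" using subgroup.subset[OF K(1)] by simp
  have HG: "H \<subseteq> carrier G" using subgroup.subset[OF H] .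
  have inj: "inj_on \<phi> (carrier ?F)" and \<phi>K: "\<And>w. w \<in> carrier ?F \<Longrightarrow> \<phi> w \<in> K"
    and mult: "\<And>u v. u \<in> carrier ?F \<Longrightarrow> v \<in> carrier ?F \<Longrightarrow> \<phi> (u \<otimes>\<^bsub>?F\<^esub> v) = \<phi> u \<otimes> \<phi> v"
    using iso by (auto simp: iso_def bij_betw_def hom_def)
  \<comment> \<open>Among positive letters nothing cancels, so every word over \<open>P\<close> is
    reduced.\<close>
  define P :: "(bool \<times> bool) set" where "P = {(True, True), (False, True)}"
  have red: "w \<in> carrier ?F" if "set w \<subseteq> P" for w
  proof -
    have "snd (w ! Suc i) = True" "snd (w ! i) = True" if "Suc i < length w" for i
      using \<open>set w \<subseteq> P\<close> that nth_mem[of i w] nth_mem[of "Suc i" w] unfolding P_def by fastforce+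
    then show ?thesis by (auto simp: free_group_def reduced_word_def inv_letter_def prod_eq_iff)
  qed
  define M where "M = max (wlen (\<phi> [(True, True)])) (wlen (\<phi> [(False, True)]))"
  have len: "wlen (\<phi> w) \<le> M * length w" if "set w \<subseteq> P" for w
    using that
  proof (induction w)
    case Nil
    have "\<phi> [] \<otimes> \<phi> [] = \<phi> []"
      using mult[of "[]" "[]"] red[of "[]"] by (simp add: free_group_def)
    moreover have "\<phi> [] \<in> carrier G" using \<phi>K red[of "[]"] KH HG by auto
    ultimately have "\<phi> [] = \<one>" by (metis r_cancel_one')
    then show ?case by simp
  next
    case (Cons l w)
    have "cons_cancel l w = l # w"
      using Cons.prems by (cases w) (auto simp: inv_letter_def P_def)
    then have "\<phi> (l # w) = \<phi> [l] \<otimes> \<phi> w"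
      using mult[of "[l]" w] red[of "[l]"] red[of w] Cons.prems by (simp add: free_group_def)
    moreover have "\<phi> [l] \<in> carrier G" "\<phi> w \<in> carrier G"
      using \<phi>K red[of "[l]"] red[of w] Cons.prems KH HG by auto
    moreover have "wlen (\<phi> [l]) \<le> M" using Cons.prems by (auto simp: P_def M_def)
    ultimately show ?case using Cons wlen_mult[of "\<phi> [l]" "\<phi> w"] by simp
  qed
  have "\<exists>A\<subseteq>H. card A = 2 ^ k \<and> (\<forall>h\<in>A. wlen h \<le> M * k)" for k
  proof -
    let ?W = "{w. set w \<subseteq> P \<and> length w = k}"
    have "inj_on \<phi> ?W" using inj red by (auto simp: inj_on_def)
    moreover have "finite P" "card P = 2" by (simp_all add: P_def)
    ultimately have "card (\<phi> ` ?W) = 2 ^ k" by (simp add: card_image card_lists_length_eq)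
    moreover have "\<phi> ` ?W \<subseteq> H" using \<phi>K red KH by auto
    ultimately show ?thesis using len by (intro exI[of _ "\<phi> ` ?W"]) auto
  qed
  then show ?thesis by blast
qed

text \<open>Squaring \<open>n + 1 \<le> 2 ^ n\<close> gives a quadratic lower bound at the exponent
  \<open>2 * n\<close>, and \<open>n = 2 * p + q\<close> makes it exceed the linear term.\<close>

lemma ex_linear_less_power2: "\<exists>k. p * k + q < (2::nat) ^ k"
proof -
  define n where "n = 2 * p + q"
  have "n + 1 \<le> (2::nat) ^ n" unfolding Suc_eq_plus1[symmetric] by (rule Suc_leI[OF less_exp])
  from mult_le_mono[OF this this] have "(n + 1) * (n + 1) \<le> 2 ^ n * 2 ^ n" .
  also have "(2::nat) ^ n * 2 ^ n = 2 ^ (2 * n)" by (simp add: power_add[symmetric] mult_2)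
  finally have "(n + 1) * (n + 1) \<le> 2 ^ (2 * n)" .
  moreover have "p * (2 * n) + q < (n + 1) * (n + 1)"
    unfolding n_def by (simp add: algebra_simps)
  ultimately show ?thesis by (meson less_le_trans)
qed

context hyp_group
begin

text \<open>Otherwise \<open>H\<close> lies in two cosets of the stabiliser of the point of
  \<open>a\<close>, and \<open>card_stabilizer_le\<close> bounds its growth linearly, against
  \<open>exponential_growth\<close>.\<close>

lemma three_translates:
  assumes H: "subgroup H G" and ne: "non_elementary (G\<lparr>carrier := H\<rparr>)" and a: "a \<in> gseqs"
  shows "\<exists>h1\<in>H. \<exists>h2\<in>H. \<exists>h3\<in>H. \<not> pdiv (\<lambda>n. h1 \<otimes> a n) (\<lambda>n. h2 \<otimes> a n) \<and>
    \<not> pdiv (\<lambda>n. h1 \<otimes> a n) (\<lambda>n. h3 \<otimes> a n) \<and> \<not> pdiv (\<lambda>n. h2 \<otimes> a n) (\<lambda>n. h3 \<otimes> a n)"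
proof (rule ccontr)
  assume no: "\<not> ?thesis"
  have HG: "\<And>h. h \<in> H \<Longrightarrow> h \<in> carrier G" using subgroup.subset[OF H] by blast
  have aX: "a n \<in> carrier G" for n using a gseqs_in by blast
  have one: "(\<lambda>n. \<one> \<otimes> a n) = a" using aX by simp
  \<comment> \<open>With \<open>\<one>\<close> and \<open>h0\<close> giving two different points,
    any further \<open>h\<close> must repeat one of them. If \<open>H\<close> fixes the point,
    \<open>h0 = \<one>\<close> will do.\<close>
  obtain h0 where h0: "h0 \<in> H"
    and alt: "\<And>h. h \<in> H \<Longrightarrow> pdiv (\<lambda>n. h \<otimes> a n) a \<or> pdiv (\<lambda>n. h \<otimes> a n) (\<lambda>n. h0 \<otimes> a n)"
  proof (cases "\<forall>h\<in>H. pdiv (\<lambda>n. h \<otimes> a n) a")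
    case True
    then show ?thesis using that[of \<one>] subgroup.one_closed[OF H] by blast
  next
    case False
    then obtain h0 where h0: "h0 \<in> H" "\<not> pdiv (\<lambda>n. h0 \<otimes> a n) a" by blast
    have "pdiv (\<lambda>n. h \<otimes> a n) a \<or> pdiv (\<lambda>n. h \<otimes> a n) (\<lambda>n. h0 \<otimes> a n)" if h: "h \<in> H" for h
    proof (rule ccontr)
      assume "\<not> ?thesis"
      then have "\<not> pdiv (\<lambda>n. h \<otimes> a n) (\<lambda>n. \<one> \<otimes> a n)" "\<not> pdiv (\<lambda>n. h \<otimes> a n) (\<lambda>n. h0 \<otimes> a n)"
        "\<not> pdiv (\<lambda>n. h0 \<otimes> a n) (\<lambda>n. \<one> \<otimes> a n)"
        using h0 one by auto
      then have "\<not> pdiv (\<lambda>n. h \<otimes> a n) (\<lambda>n. h0 \<otimes> a n) \<and> \<not> pdiv (\<lambda>n. h \<otimes> a n) (\<lambda>n. \<one> \<otimes> a n) \<and>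
        \<not> pdiv (\<lambda>n. h0 \<otimes> a n) (\<lambda>n. \<one> \<otimes> a n)" by blast
      then show False using no h h0(1) subgroup.one_closed[OF H] by blast
    qed
    then show ?thesis using that h0(1) by blast
  qed
  \<comment> \<open>Multiplying the second coset by \<open>inv h0\<close> moves it into the
    stabiliser and adds at most \<open>c\<close> to lengths.\<close>
  define c where "c = wlen h0"
  define k where "k = card {g \<in> carrier G. wlen g \<le> nat \<lceil>6 * \<delta>\<rceil>}"
  have growth: "card A \<le> 2 * ((2 * (n + c) + 1) * k)"
    if A: "finite A" "A \<subseteq> H" "\<And>h. h \<in> A \<Longrightarrow> wlen h \<le> n" for A n
  proof -
    define A1 where "A1 = {h \<in> A. pdiv (\<lambda>n. h \<otimes> a n) a}"
    define A2 where "A2 = {h \<in> A. pdiv (\<lambda>n. h \<otimes> a n) (\<lambda>n. h0 \<otimes> a n)}"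
    have AG: "h \<in> carrier G" if "h \<in> A" for h using that A HG by blast
    have h0G: "h0 \<in> carrier G" using h0 HG by blast
    have "A = A1 \<union> A2" using alt A by (auto simp: A1_def A2_def)
    then have "card A \<le> card A1 + card A2" by (metis card_Un_le)
    moreover have "card A1 \<le> (2 * (n + c) + 1) * k"
      unfolding k_def
    proof (rule card_stabilizer_le[OF a])
      show "wlen h \<le> n + c" if "h \<in> A1" for h
        using that A(3)[of h] by (auto simp: A1_def)
    qed (use A AG in \<open>auto simp: A1_def\<close>)
    moreover have "card ((\<lambda>h. inv h0 \<otimes> h) ` A2) \<le> (2 * (n + c) + 1) * k"
      unfolding k_def
    proof (rule card_stabilizer_le[OF a])
      fix g assume "g \<in> (\<lambda>h. inv h0 \<otimes> h) ` A2"
      then obtain h where h: "h \<in> A" "pdiv (\<lambda>n. h \<otimes> a n) (\<lambda>n. h0 \<otimes> a n)" "g = inv h0 \<otimes> h"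
        by (auto simp: A2_def)
      show "wlen g \<le> n + c"
        using wlen_mult[of "inv h0" h] A(3)[OF h(1)] AG[OF h(1)] h0G h by (simp add: c_def)
      have "pdiv (\<lambda>n. inv h0 \<otimes> (h \<otimes> a n)) (\<lambda>n. inv h0 \<otimes> (h0 \<otimes> a n))"
        by (rule pdiv_translate) (use h h0G AG aX in auto)
      then show "pdiv (\<lambda>n. g \<otimes> a n) a"
        using h h0G AG[OF h(1)] aX by (simp add: m_assoc[symmetric])
    qed (use A AG h0G in \<open>auto simp: A2_def\<close>)
    moreover have "card ((\<lambda>h. inv h0 \<otimes> h) ` A2) = card A2"
      using AG h0G by (intro card_image) (auto simp: inj_on_def A2_def)
    ultimately show ?thesis by simp
  qed
  obtain M where M: "\<And>j. \<exists>A\<subseteq>H. card A = 2 ^ j \<and> (\<forall>h\<in>A. wlen h \<le> M * j)"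
    using exponential_growth[OF H ne] by blast
  obtain j where j: "(4 * M * k) * j + 2 * (2 * c + 1) * k < 2 ^ j"
    using ex_linear_less_power2 by blast
  obtain A where A: "A \<subseteq> H" "card A = 2 ^ j" "\<forall>h\<in>A. wlen h \<le> M * j" using M by blast
  \<comment> \<open>An infinite set has \<open>card\<close> equal to 0, which is not a power of
    two.\<close>
  have "finite A" using A(2) by (metis card.infinite power_not_zero zero_neq_numeral)
  then have "2 ^ j \<le> 2 * ((2 * (M * j + c) + 1) * k)" using growth[of A "M * j"] A by auto
  then show False using j by (simp add: algebra_simps)
qed

end

lemma (in fg_group) non_elementary_infinite:
  assumes "non_elementary G"
  shows "infinite (carrier G)"
proof
  assume fin: "finite (carrier G)"
  obtain M where M: "\<And>k. \<exists>A\<subseteq>carrier G. card A = 2 ^ k \<and> (\<forall>h\<in>A. wlen h \<le> M * k)"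
    using exponential_growth[OF subgroup_self] assms by auto
  obtain A where A: "A \<subseteq> carrier G" "card A = 2 ^ card (carrier G)" using M by blast
  have "card A \<le> card (carrier G)" using card_mono[OF fin A(1)] .
  then show False using A(2) less_exp[of "card (carrier G)"] by linarith
qed

section \<open>Cannon--Thurston maps\<close>

text \<open>An extension fixes the terms of \<open>a\<close>, so by continuity \<open>a\<close>
  converges in the compactification of \<open>G\<close> to the image of its class. That limit is a
  boundary point, and \<open>a\<close> represents it. This holds for whichever extension
  \<open>SOME\<close> returns.\<close>

lemma cannon_thurston_map_seq_class:
  assumes L: "hyp_group L T \<delta>" and G: "hyp_group G S \<delta>'" and LG: "carrier L \<subseteq> carrier G"
    and ex: "cannon_thurston_exists L T G S"
    and a: "a \<in> gromov_sequences (carrier L) (\<lambda>x y. real (word_dist L T x y)) \<one>\<^bsub>L\<^esub>"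
  shows "a \<in> gromov_sequences (carrier G) (\<lambda>x y. real (word_dist G S x y)) \<one>\<^bsub>G\<^esub>"
    and "cannon_thurston_map L T G S
      (hyperbolic_space.seq_class (carrier L) (\<lambda>x y. real (word_dist L T x y)) \<one>\<^bsub>L\<^esub> a) =
      hyperbolic_space.seq_class (carrier G) (\<lambda>x y. real (word_dist G S x y)) \<one>\<^bsub>G\<^esub> a"
proof -
  interpret L: hyp_group L T \<delta> by (rule L)
  interpret G: hyp_group G S \<delta>' by (rule G)
  define F where "F = (SOME F. cannon_thurston_extension L T G S F)"
  have "cannon_thurston_extension L T G S F"
    unfolding F_def using ex unfolding cannon_thurston_exists_def by (rule someI_ex)
  then have cont: "continuous_map (group_compactification L T) (group_compactification G S) F"
    and F: "\<And>h. h \<in> carrier L \<Longrightarrow> F (Inl h) = Inl h"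
    by (auto simp: cannon_thurston_extension_def)
  let ?\<xi> = "L.seq_class a"
  have \<xi>: "?\<xi> \<in> L.bdry" "a \<in> ?\<xi>" using a L.seq_class_in_bdry L.self_in_seq_class by blast+
  have aL: "a n \<in> carrier L" for n using a L.gseqs_in by blast
  have "limitin (group_compactification G S) (F \<circ> (\<lambda>n. Inl (a n))) (F (Inr ?\<xi>)) sequentially"
    using continuous_map_limit[OF cont L.limitin_boundary_point[OF \<xi>]] .
  moreover have "F \<circ> (\<lambda>n. Inl (a n)) = (\<lambda>n. Inl (a n))" using F aL by auto
  ultimately have lim: "limitin (group_compactification G S) (\<lambda>n. Inl (a n)) (F (Inr ?\<xi>)) sequentially"
    by simp
  have inc: "F (Inr ?\<xi>) \<in> compactification (carrier G) (\<lambda>x y. real (word_dist G S x y)) \<one>\<^bsub>G\<^esub>"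
    using limitin_topspace[OF lim] by simp
  obtain \<eta> where \<eta>: "F (Inr ?\<xi>) = Inr \<eta>" "\<eta> \<in> G.bdry" and aG: "a \<in> \<eta>"
  proof (cases "F (Inr ?\<xi>)")
    case (Inl x)
    \<comment> \<open>If the image were a group element, an isolated point, \<open>a\<close> would
      be eventually constant, which no Gromov sequence is.\<close>
    have "openin (group_compactification G S) {Inl x}"
      using inc Inl by (intro G.openin_singleton_Inl) (auto simp: compactification_def)
    then obtain M where M: "\<And>n. n \<ge> M \<Longrightarrow> a n = x"
      using lim Inl unfolding limitin_def eventually_sequentially by blast
    then have "limitin (group_compactification L T) (\<lambda>n. Inl (a n)) (Inl x) sequentially"
      using aL[of M] by (intro limitin_eventually)
        (auto simp: eventually_sequentially compactification_def)
    then show ?thesis using L.not_limitin_Inl[OF a] by blast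
  next
    case (Inr \<eta>)
    moreover have \<eta>: "\<eta> \<in> G.bdry" using inc Inr by (auto simp: compactification_def)
    moreover have "a \<in> \<eta>"
      using G.limitin_boundary_pointD[OF \<eta>, of a] lim Inr aL LG by auto
    ultimately show ?thesis using that by blast
  qed
  then show "a \<in> G.gseqs" using G.bdry_subset by blast
  have "cannon_thurston_map L T G S ?\<xi> = \<eta>"
    using \<eta> by (simp add: cannon_thurston_map_def F_def)
  then show "cannon_thurston_map L T G S ?\<xi> = G.seq_class a"
    using G.bdry_eq_seq_class \<eta>(2) aG by simp
qed

section \<open>Visual powers, distortion and the final estimate\<close>

lemma visual_power_le:
  assumes "r > 1" "ereal R \<le> t"
  shows "visual_power r t \<le> r powr (- R)"
proof (cases t)
  case (real x)
  then show ?thesis using assms by (simp add: visual_power_def)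
qed (use assms in \<open>auto simp: visual_power_def\<close>)

text \<open>The assumption \<open>0 \<le> R\<close> covers \<open>t = - \<infinity>\<close>, where \<^const>\<open>real_of_ereal\<close> is \<open>0\<close>.\<close>

lemma visual_power_ge:
  assumes "r > 1" "t \<le> ereal R" "0 \<le> R"
  shows "r powr (- R) \<le> visual_power r t"
proof (cases t)
  case (real x)
  then show ?thesis using assms by (simp add: visual_power_def)
next
  case MInf
  then show ?thesis using assms powr_mono[of "- R" 0 r] by (simp add: visual_power_def)
qed (use assms in auto)

text \<open>Balls of \<open>G\<close> are finite and contain \<open>\<one>\<close>, so
  \<open>Max\<close> is taken over a finite nonempty set and is attained.\<close>

lemma (in fg_group) distortion_attained:
  assumes "group L" "carrier L \<subseteq> carrier G" "\<one>\<^bsub>L\<^esub> = \<one>"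
  obtains h where "h \<in> carrier L" "word_dist L T \<one>\<^bsub>L\<^esub> h = distortion L T G S n" "wlen h \<le> n"
proof -
  let ?H = "{h. h \<in> carrier L \<and> wdist \<one> h \<le> n}"
  have eq: "{word_dist L T \<one>\<^bsub>L\<^esub> h |h. h \<in> carrier L \<and> wdist \<one> h \<le> n} = word_dist L T \<one>\<^bsub>L\<^esub> ` ?H"
    by auto
  have "?H \<subseteq> {h \<in> carrier G. wlen h \<le> n}" using assms(2) by auto
  then have "finite ?H" using finite_wlen_ball finite_subset by blast
  moreover have "\<one>\<^bsub>L\<^esub> \<in> ?H" using assms monoid.one_closed[OF group.is_monoid[OF assms(1)]] by simp
  ultimately have "distortion L T G S n \<in> word_dist L T \<one>\<^bsub>L\<^esub> ` ?H"
    unfolding distortion_def eq by (intro Max_in) auto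
  then show ?thesis using that assms(2) by auto
qed

theorem theorem1p2:
  fixes \<Gamma> :: "('a, 'b) monoid_scheme" and H S T :: "'a set"
    and r s :: real
    and d\<^sub>\<Lambda> d\<^sub>\<Gamma> :: "(nat \<Rightarrow> 'a) set \<Rightarrow> (nat \<Rightarrow> 'a) set \<Rightarrow> real"
  defines "\<Lambda> \<equiv> \<Gamma>\<lparr>carrier := H\<rparr>"
  assumes "hyperbolic_group \<Gamma> S"
    and "subgroup H \<Gamma>"
    and "hyperbolic_group \<Lambda> T"
    and "non_elementary \<Lambda>"
    and "cannon_thurston_exists \<Lambda> T \<Gamma> S"
    and "r > 1" and "s > 1"
    and "group_visual_metric \<Lambda> T d\<^sub>\<Lambda> r"
    and "group_visual_metric \<Gamma> S d\<^sub>\<Gamma> s"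
  defines "\<epsilon> \<equiv> modulus_of_continuity (group_boundary \<Lambda> T) d\<^sub>\<Lambda> d\<^sub>\<Gamma> (cannon_thurston_map \<Lambda> T \<Gamma> S)"
  shows "\<exists>\<alpha>>0. \<exists>\<beta>>0. \<forall>n::nat.
           \<epsilon> (\<beta> / r ^ distortion \<Lambda> T \<Gamma> S n) \<ge> ennreal (\<alpha> / s ^ n)"
proof -
  obtain \<delta>' where "hyp_group \<Gamma> S \<delta>'" using hyperbolic_group_hyp_group assms by blast
  then interpret G: hyp_group \<Gamma> S \<delta>' .
  obtain \<delta> where "hyp_group \<Lambda> T \<delta>" using hyperbolic_group_hyp_group assms by blast
  then interpret L: hyp_group \<Lambda> T \<delta> .
  have car: "carrier \<Lambda> = H" and mult: "x \<otimes>\<^bsub>\<Lambda>\<^esub> y = x \<otimes>\<^bsub>\<Gamma>\<^esub> y" and one: "\<one>\<^bsub>\<Lambda>\<^esub> = \<one>\<^bsub>\<Gamma>\<^esub>" for x y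
    by (simp_all add: \<Lambda>_def)
  have HG: "carrier \<Lambda> \<subseteq> carrier \<Gamma>" using subgroup.subset[OF \<open>subgroup H \<Gamma>\<close>] by (simp add: car)
  note CT = cannon_thurston_map_seq_class[OF L.hyp_group_axioms G.hyp_group_axioms HG
      \<open>cannon_thurston_exists \<Lambda> T \<Gamma> S\<close>]
  \<comment> \<open>Equal classes have equal images. Contrapositively, sequences separated in
    \<open>\<Gamma>\<close> are separated in \<open>\<Lambda>\<close>.\<close>
  have pdiv_LG: "G.pdiv a b" if "a \<in> L.gseqs" "b \<in> L.gseqs" "L.pdiv a b" for a b
  proof -
    have "b \<in> L.seq_class a" using that by (simp add: L.seq_class_def)
    then have "L.seq_class a = L.seq_class b"
      using L.bdry_eq_seq_class L.seq_class_in_bdry that by blast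
    then have "G.seq_class a = G.seq_class b" using CT(2) that by metis
    then have "b \<in> G.seq_class a" using G.self_in_seq_class CT(1) that by blast
    then show ?thesis by (simp add: G.seq_class_def)
  qed
  obtain a where a: "a \<in> L.gseqs"
    using L.ex_gromov_sequence L.non_elementary_infinite \<open>non_elementary \<Lambda>\<close> by blast
  obtain h1 h2 h3 where h: "h1 \<in> H" "h2 \<in> H" "h3 \<in> H" and
    nd: "\<not> G.pdiv (\<lambda>n. h1 \<otimes>\<^bsub>\<Gamma>\<^esub> a n) (\<lambda>n. h2 \<otimes>\<^bsub>\<Gamma>\<^esub> a n)"
    "\<not> G.pdiv (\<lambda>n. h1 \<otimes>\<^bsub>\<Gamma>\<^esub> a n) (\<lambda>n. h3 \<otimes>\<^bsub>\<Gamma>\<^esub> a n)"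
    "\<not> G.pdiv (\<lambda>n. h2 \<otimes>\<^bsub>\<Gamma>\<^esub> a n) (\<lambda>n. h3 \<otimes>\<^bsub>\<Gamma>\<^esub> a n)"
    using G.three_translates[OF \<open>subgroup H \<Gamma>\<close> _ CT(1)[OF a]] \<open>non_elementary \<Lambda>\<close> unfolding \<Lambda>_def by blast
  define x y z where "x = (\<lambda>n. h1 \<otimes>\<^bsub>\<Gamma>\<^esub> a n)" and "y = (\<lambda>n. h2 \<otimes>\<^bsub>\<Gamma>\<^esub> a n)" and "z = (\<lambda>n. h3 \<otimes>\<^bsub>\<Gamma>\<^esub> a n)"
  have xyz: "x \<in> L.gseqs" "y \<in> L.gseqs" "z \<in> L.gseqs"
    using L.gseqs_translate[OF _ a] h unfolding x_def y_def z_def mult car by blast+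
  \<comment> \<open>The bound in \<open>\<Lambda>\<close> feeds the alternative \<open>E\<close>,
    the one in \<open>\<Gamma>\<close> the upper estimate of the translated boundary
    product.\<close>
  define B where "B p q C \<longleftrightarrow> (\<exists>N. \<forall>m\<ge>N. \<forall>n\<ge>N. L.gp \<one>\<^bsub>\<Lambda>\<^esub> (p m) (q n) \<le> C \<and> G.gp \<one>\<^bsub>\<Gamma>\<^esub> (p m) (q n) \<le> C)"
    for p q :: "nat \<Rightarrow> 'a" and C :: real
  have ex_B: "\<exists>C. B p q C" if pq: "p \<in> L.gseqs" "q \<in> L.gseqs" "\<not> G.pdiv p q" for p q
  proof -
    obtain C1 N1 where 1: "\<forall>m\<ge>N1. \<forall>n\<ge>N1. L.gp \<one>\<^bsub>\<Lambda>\<^esub> (p m) (q n) \<le> C1"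
      using L.not_products_diverge[OF pq(1,2)] pdiv_LG pq by blast
    obtain C2 N2 where 2: "\<forall>m\<ge>N2. \<forall>n\<ge>N2. G.gp \<one>\<^bsub>\<Gamma>\<^esub> (p m) (q n) \<le> C2"
      using G.not_products_diverge[OF CT(1)[OF pq(1)] CT(1)[OF pq(2)] pq(3)] by blast
    have "B p q (max C1 C2)"
      unfolding B_def by (rule exI[of _ "max N1 N2"]) (use 1 2 in \<open>simp add: le_max_iff_disj\<close>)
    then show ?thesis by blast
  qed
  have B_mono: "B p q C'" if "B p q C" "C \<le> C'" for p q C C'
    using that unfolding B_def by (meson order_trans)
  obtain C1 C2 C3 where C123: "B x y C1" "B x z C2" "B y z C3"
    using ex_B xyz nd unfolding x_def[symmetric] y_def[symmetric] z_def[symmetric] by meson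
  \<comment> \<open>The maximum with 0 makes \<open>real n + c1\<close> nonnegative, as
    \<open>visual_power_ge\<close> requires.\<close>
  define C where "C = max 0 (max C1 (max C2 C3))"
  have C0: "0 \<le> C" by (simp add: C_def)
  have C: "B x y C" "B x z C" "B y z C"
    using C123 by (auto intro: B_mono simp: C_def le_max_iff_disj)
  define E where "E g p \<longleftrightarrow> (\<exists>K. \<forall>m\<ge>K. L.gp \<one>\<^bsub>\<Lambda>\<^esub> g (p m) \<le> C + 2 * \<delta> + 1)"
    for g :: 'a and p :: "nat \<Rightarrow> 'a"
  have E: "E g p \<or> E g q" if "B p q C" "p \<in> L.gseqs" "q \<in> L.gseqs" "g \<in> carrier \<Lambda>" for g p q
    using that L.bounded_product_alternative[of p q _ C g] unfolding B_def E_def by meson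
  obtain k2 where k2: "k2 > 0" "\<And>\<xi> \<eta>. \<xi> \<in> L.bdry \<Longrightarrow> \<eta> \<in> L.bdry \<Longrightarrow> d\<^sub>\<Lambda> \<xi> \<eta> \<le> k2 * visual_power r (L.bprod \<xi> \<eta>)"
    using \<open>group_visual_metric \<Lambda> T d\<^sub>\<Lambda> r\<close> unfolding visual_metric_def by blast
  obtain k1 where k1: "k1 > 0" "\<And>\<xi> \<eta>. \<xi> \<in> G.bdry \<Longrightarrow> \<eta> \<in> G.bdry \<Longrightarrow> k1 * visual_power s (G.bprod \<xi> \<eta>) \<le> d\<^sub>\<Gamma> \<xi> \<eta>"
    using \<open>group_visual_metric \<Gamma> S d\<^sub>\<Gamma> s\<close> unfolding visual_metric_def by blast
  \<comment> \<open>\<open>c1\<close> collects the errors of \<open>bprod_translate_le\<close> in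
    \<open>\<Gamma>\<close>, \<open>c2\<close> those of \<open>bprod_translate_ge\<close> in
    \<open>\<Lambda>\<close> with the bound from \<open>E\<close>.\<close>
  define c1 where "c1 = C + 2 * \<delta>' + 1"
  define c2 where "c2 = C + 3 * \<delta> + 1"
  define \<alpha> where "\<alpha> = k1 * s powr (- c1)"
  define \<beta> where "\<beta> = k2 * r powr c2"
  have "\<alpha> > 0" "\<beta> > 0" using k1 k2 \<open>r > 1\<close> \<open>s > 1\<close> by (simp_all add: \<alpha>_def \<beta>_def)
  moreover have "\<epsilon> (\<beta> / r ^ distortion \<Lambda> T \<Gamma> S n) \<ge> ennreal (\<alpha> / s ^ n)" for n
  proof -
    obtain h where h: "h \<in> carrier \<Lambda>" "L.wlen h = distortion \<Lambda> T \<Gamma> S n" "G.wlen h \<le> n"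
      using G.distortion_attained[OF L.is_group HG one, of T n] by auto
    have hG: "h \<in> carrier \<Gamma>" using h HG by blast
    have "inv\<^bsub>\<Lambda>\<^esub> h \<in> carrier \<Lambda>" using h by simp
    \<comment> \<open>Of any two among \<open>x\<close>, \<open>y\<close>, \<open>z\<close> at least
      one satisfies \<open>E\<close>, so two of the three do. The pair depends on \<open>n\<close>,
      but the three sequences do not, which makes the constants uniform.\<close>
    then obtain p q where pq: "p \<in> L.gseqs" "q \<in> L.gseqs" "B p q C" "E (inv\<^bsub>\<Lambda>\<^esub> h) p" "E (inv\<^bsub>\<Lambda>\<^esub> h) q"
      using E C xyz by metis
    define p' q' where "p' = (\<lambda>m. h \<otimes>\<^bsub>\<Gamma>\<^esub> p m)" and "q' = (\<lambda>m. h \<otimes>\<^bsub>\<Gamma>\<^esub> q m)"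
    have pq': "p' \<in> L.gseqs" "q' \<in> L.gseqs"
      using L.gseqs_translate[OF h(1)] pq unfolding p'_def q'_def mult by blast+
    have pqG: "p \<in> G.gseqs" "q \<in> G.gseqs" "p' \<in> G.gseqs" "q' \<in> G.gseqs"
      using CT(1) pq pq' by blast+
    obtain K1 K2 where K: "\<And>m. m \<ge> K1 \<Longrightarrow> L.gp \<one>\<^bsub>\<Lambda>\<^esub> (inv\<^bsub>\<Lambda>\<^esub> h) (p m) \<le> C + 2 * \<delta> + 1"
      "\<And>m. m \<ge> K2 \<Longrightarrow> L.gp \<one>\<^bsub>\<Lambda>\<^esub> (inv\<^bsub>\<Lambda>\<^esub> h) (q m) \<le> C + 2 * \<delta> + 1"
      using pq(4,5) unfolding E_def by meson
    obtain N where N: "\<And>m n. m \<ge> N \<Longrightarrow> n \<ge> N \<Longrightarrow> G.gp \<one>\<^bsub>\<Gamma>\<^esub> (p m) (q n) \<le> C"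
      using pq(3) unfolding B_def by meson
    have "ereal (real (L.wlen h) - c2) \<le> L.bprod (L.seq_class p') (L.seq_class q')"
      using L.bprod_translate_ge[OF h(1) pq(1,2) K] unfolding p'_def q'_def c2_def mult
      by (simp add: algebra_simps)
    then have "visual_power r (L.bprod (L.seq_class p') (L.seq_class q')) \<le> r powr (- (real (L.wlen h) - c2))"
      by (rule visual_power_le[OF \<open>r > 1\<close>])
    also have "\<dots> = r powr c2 / r ^ distortion \<Lambda> T \<Gamma> S n"
      using \<open>r > 1\<close> h(2) by (simp add: powr_diff powr_realpow)
    finally have dL: "d\<^sub>\<Lambda> (L.seq_class p') (L.seq_class q') \<le> \<beta> / r ^ distortion \<Lambda> T \<Gamma> S n"
      using k2(2)[OF L.seq_class_in_bdry L.seq_class_in_bdry, OF pq'] k2(1)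
      unfolding \<beta>_def by (smt (verit) mult_left_mono times_divide_eq_right)
    have "G.bprod (G.seq_class p') (G.seq_class q') \<le> ereal (C + real (G.wlen h) + 2 * \<delta>' + 1)"
      unfolding p'_def q'_def by (rule G.bprod_translate_le[OF hG pqG(1,2) N])
    also have "\<dots> \<le> ereal (real n + c1)" using h(3) by (simp add: c1_def)
    finally have "s powr (- (real n + c1)) \<le> visual_power s (G.bprod (G.seq_class p') (G.seq_class q'))"
      using C0 G.delta_nonneg by (intro visual_power_ge[OF \<open>s > 1\<close>]) (auto simp: c1_def)
    moreover have "- (real n + c1) = - c1 - real n" by simp
    then have "s powr (- (real n + c1)) = s powr (- c1) / s ^ n"
      using \<open>s > 1\<close> by (simp only: powr_diff) (simp add: powr_realpow)
    ultimately have dG: "\<alpha> / s ^ n \<le> d\<^sub>\<Gamma> (G.seq_class p') (G.seq_class q')"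
      using k1(2)[OF G.seq_class_in_bdry G.seq_class_in_bdry, OF pqG(3,4)] k1(1)
      unfolding \<alpha>_def by (smt (verit) mult_left_mono times_divide_eq_right)
    \<comment> \<open>By \<open>CT\<close> the images of the two classes are the classes of the same
      sequences in \<open>\<Gamma>\<close>, so this pair competes in the supremum.\<close>
    have "ennreal (d\<^sub>\<Gamma> (G.seq_class p') (G.seq_class q')) \<le> \<epsilon> (\<beta> / r ^ distortion \<Lambda> T \<Gamma> S n)"
      unfolding \<epsilon>_def modulus_of_continuity_def
    proof (rule Sup_upper, rule CollectI, intro exI conjI)
      show "ennreal (d\<^sub>\<Gamma> (G.seq_class p') (G.seq_class q')) =
        ennreal (d\<^sub>\<Gamma> (cannon_thurston_map \<Lambda> T \<Gamma> S (L.seq_class p')) (cannon_thurston_map \<Lambda> T \<Gamma> S (L.seq_class q')))"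
        using CT(2) pq' by simp
    qed (use L.seq_class_in_bdry pq' dL in auto)
    then show ?thesis using dG by (meson ennreal_leI order_trans)
  qed
  ultimately show ?thesis by blast
qed

end
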